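(* Let $(X,\mathcal{X},\mu)$ be a $\sigma$-finite measure space and $(\mathcal{E},\mathcal{F})$ a Dirichlet form on $L_2(X,\mu)$. Let $\mathcal{B}:=\{f\in b\mathcal{X}: \text{the }\mu\text{-class of }f\text{ lies in }\mathcal{F}\}$, where $b\mathcal{X}$ denotes the bounded $\mathcal{X}$-measurable real functions, and set $\mathcal{E}(f,g):=\mathcal{E}([f],[g])$ for $f,g\in\mathcal{B}$ (with $[f]$ the $\mu$-class). Then $L_f(h):=2\mathcal{E}(fh,f)-\mathcal{E}(f^2,h)$, $f,h\in\mathcal{B}$, polarized to $L_{f,g}:=\frac14(L_{f+g}-L_{f-g})$, defines a sup-norm-closable Lagrangian $(L,\mathcal{B})$ on which normal contractions operate. Moreover $(\mathcal{E},\mathcal{B})$ is a sup-norm-closable bilinear form on which normal contractions operate.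
   Context: Functions spaces carry the supremum norm $\|f\|_{\sup}=\sup_{x}|f(x)|$; $\mathcal{D}^+$ denotes nonnegative elements. A bilinear form is a symmetric nonnegative definite bilinear map; $\mathcal{E}(f):=\mathcal{E}(f,f)$. It is sup-norm-closable if every $\mathcal{E}$-Cauchy sequence $(f_n)$ with $\|f_n\|_{\sup}\to0$ satisfies $\mathcal{E}(f_n)\to0$. A normal contraction is $F:\mathbb{R}\to\mathbb{R}$ with $F(0)=0$, $|F(x)-F(y)|\le|x-y|$; normal contractions operate on $(\mathcal{E},\mathcal{D})$ if $F(f)\in\mathcal{D}$ and $\mathcal{E}(F(f))\le\mathcal{E}(f)$. Unit contraction: $T_1(x)=\max(x,0)\wedge1$. For an algebra $\mathcal{D}$ of bounded functions with $f\wedge 1\in\mathcal{D}$ for all $f\in\mathcal{D}$, a Lagrangian is a symmetric bilinear map $(f,g)\mapsto L_{f,g}$ from $\mathcal{D}\times\mathcal{D}$ into the dual $\mathcal{D}'$ of $(\mathcal{D},\|\cdot\|_{\sup})$ such that each $L_f:=L_{f,f}$ is positive ($h\ge0\Rightarrow L_f(h)\ge0$) and $L_f-L_{T_1(f)}$ is positive for all $f$. Normal contractions operate on $(L,\mathcal{D})$ if $\mathcal{D}$ is stable under normal contractions and $L_f-L_{F(f)}$ is positive for every $f$ and normal contraction $F$. A Lagrangian is sup-norm-closable if for each $h\in\mathcal{D}^+$ the bilinear form $(f,g)\mapsto L_{f,g}(h)$ is sup-norm-closable. *)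

theory Defs
  imports "HOL-Analysis.Analysis"
begin

type_synonym 'a rfun = "'a \<Rightarrow> real"

definition supn :: "'a measure \<Rightarrow> 'a rfun \<Rightarrow> real" where
  "supn M f = (SUP x\<in>space M. \<bar>f x\<bar>)"

definition T1 :: "real \<Rightarrow> real" where
  "T1 x = min (max x 0) 1"

definition normal_contraction :: "(real \<Rightarrow> real) \<Rightarrow> bool" where
  "normal_contraction F \<longleftrightarrow> F 0 = 0 \<and> (\<forall>x y. \<bar>F x - F y\<bar> \<le> \<bar>x - y\<bar>)"

definition lin_subspace :: "'a rfun set \<Rightarrow> bool" where
  "lin_subspace D \<longleftrightarrow> (\<lambda>x. 0) \<in> D \<and>
     (\<forall>f\<in>D. \<forall>g\<in>D. (\<lambda>x. f x + g x) \<in> D) \<and>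
     (\<forall>c::real. \<forall>f\<in>D. (\<lambda>x. c * f x) \<in> D)"

definition bilinear_form :: "'a rfun set \<Rightarrow> ('a rfun \<Rightarrow> 'a rfun \<Rightarrow> real) \<Rightarrow> bool" where
  "bilinear_form D E \<longleftrightarrow> lin_subspace D \<and>
     (\<forall>f\<in>D. \<forall>g\<in>D. E f g = E g f) \<and>
     (\<forall>c::real. \<forall>f\<in>D. \<forall>f'\<in>D. \<forall>g\<in>D. E (\<lambda>x. c * f x + f' x) g = c * E f g + E f' g) \<and>
     (\<forall>f\<in>D. E f f \<ge> 0)"

definition form_cauchy :: "('a rfun \<Rightarrow> 'a rfun \<Rightarrow> real) \<Rightarrow> (nat \<Rightarrow> 'a rfun) \<Rightarrow> bool" where
  "form_cauchy E fs \<longleftrightarrow> (\<forall>e>0. \<exists>N. \<forall>m\<ge>N. \<forall>n\<ge>N.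
      E (\<lambda>x. fs n x - fs m x) (\<lambda>x. fs n x - fs m x) < e)"

definition sup_closable :: "'a measure \<Rightarrow> 'a rfun set \<Rightarrow> ('a rfun \<Rightarrow> 'a rfun \<Rightarrow> real) \<Rightarrow> bool" where
  "sup_closable M D E \<longleftrightarrow> (\<forall>fs. (\<forall>n. fs n \<in> D) \<and> form_cauchy E fs \<and>
      (\<lambda>n. supn M (fs n)) \<longlonglongrightarrow> 0 \<longrightarrow> (\<lambda>n. E (fs n) (fs n)) \<longlonglongrightarrow> 0)"

definition contractions_operate :: "'a rfun set \<Rightarrow> ('a rfun \<Rightarrow> 'a rfun \<Rightarrow> real) \<Rightarrow> bool" where
  "contractions_operate D E \<longleftrightarrow> (\<forall>F f. normal_contraction F \<and> f \<in> D \<longrightarrow>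
      (F \<circ> f) \<in> D \<and> E (F \<circ> f) (F \<circ> f) \<le> E f f)"

definition in_dual :: "'a measure \<Rightarrow> 'a rfun set \<Rightarrow> ('a rfun \<Rightarrow> real) \<Rightarrow> bool" where
  "in_dual M D ell \<longleftrightarrow>
     (\<forall>c::real. \<forall>h\<in>D. \<forall>h'\<in>D. ell (\<lambda>x. c * h x + h' x) = c * ell h + ell h') \<and>
     (\<exists>C. \<forall>h\<in>D. \<bar>ell h\<bar> \<le> C * supn M h)"

definition nonneg_fun :: "'a measure \<Rightarrow> 'a rfun \<Rightarrow> bool" where
  "nonneg_fun M h \<longleftrightarrow> (\<forall>x\<in>space M. h x \<ge> 0)"

definition bounded_algebra :: "'a measure \<Rightarrow> 'a rfun set \<Rightarrow> bool" where
  "bounded_algebra M D \<longleftrightarrow> lin_subspace D \<and>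
     (\<forall>f\<in>D. \<forall>g\<in>D. (\<lambda>x. f x * g x) \<in> D) \<and>
     (\<forall>f\<in>D. bounded (f ` space M)) \<and>
     (\<forall>f\<in>D. (\<lambda>x. min (f x) 1) \<in> D)"

definition lagrangian :: "'a measure \<Rightarrow> 'a rfun set \<Rightarrow> ('a rfun \<Rightarrow> 'a rfun \<Rightarrow> 'a rfun \<Rightarrow> real) \<Rightarrow> bool" where
  "lagrangian M D L \<longleftrightarrow> bounded_algebra M D \<and>
     (\<forall>f\<in>D. \<forall>g\<in>D. in_dual M D (L f g)) \<and>
     (\<forall>f\<in>D. \<forall>g\<in>D. \<forall>h\<in>D. L f g h = L g f h) \<and>
     (\<forall>c::real. \<forall>f\<in>D. \<forall>f'\<in>D. \<forall>g\<in>D. \<forall>h\<in>D.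
        L (\<lambda>x. c * f x + f' x) g h = c * L f g h + L f' g h) \<and>
     (\<forall>f\<in>D. \<forall>h\<in>D. nonneg_fun M h \<longrightarrow> L f f h \<ge> 0) \<and>
     (\<forall>f\<in>D. \<forall>h\<in>D. nonneg_fun M h \<longrightarrow> L (T1 \<circ> f) (T1 \<circ> f) h \<le> L f f h)"

definition lagr_contractions_operate :: "'a measure \<Rightarrow> 'a rfun set \<Rightarrow> ('a rfun \<Rightarrow> 'a rfun \<Rightarrow> 'a rfun \<Rightarrow> real) \<Rightarrow> bool" where
  "lagr_contractions_operate M D L \<longleftrightarrow> (\<forall>F f. normal_contraction F \<and> f \<in> D \<longrightarrow>
      (F \<circ> f) \<in> D \<and> (\<forall>h\<in>D. nonneg_fun M h \<longrightarrow> L (F \<circ> f) (F \<circ> f) h \<le> L f f h))"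

definition lagr_sup_closable :: "'a measure \<Rightarrow> 'a rfun set \<Rightarrow> ('a rfun \<Rightarrow> 'a rfun \<Rightarrow> 'a rfun \<Rightarrow> real) \<Rightarrow> bool" where
  "lagr_sup_closable M D L \<longleftrightarrow>
     (\<forall>h\<in>D. nonneg_fun M h \<longrightarrow> sup_closable M D (\<lambda>f g. L f g h))"

text \<open>L2(X,mu) is modelled by its representatives: measurable square-integrable functions.
  A form on L2 is modelled by a domain F of representatives that is saturated under
  mu-a.e. equality, together with E invariant under a.e. equality.\<close>
definition L2fun :: "'a measure \<Rightarrow> 'a rfun \<Rightarrow> bool" where
  "L2fun M f \<longleftrightarrow> f \<in> borel_measurable M \<and> integrable M (\<lambda>x. (f x)\<^sup>2)"

definition L2dist2 :: "'a measure \<Rightarrow> 'a rfun \<Rightarrow> 'a rfun \<Rightarrow> real" where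
  "L2dist2 M f g = (\<integral>x. (f x - g x)\<^sup>2 \<partial>M)"

definition E1 :: "'a measure \<Rightarrow> ('a rfun \<Rightarrow> 'a rfun \<Rightarrow> real) \<Rightarrow> 'a rfun \<Rightarrow> 'a rfun \<Rightarrow> real" where
  "E1 M E f g = E (\<lambda>x. f x - g x) (\<lambda>x. f x - g x) + L2dist2 M f g"

definition dirichlet_form :: "'a measure \<Rightarrow> 'a rfun set \<Rightarrow> ('a rfun \<Rightarrow> 'a rfun \<Rightarrow> real) \<Rightarrow> bool" where
  "dirichlet_form M F E \<longleftrightarrow>
     \<comment> \<open>F is a set of (representatives of) elements of L2, saturated under a.e. equality\<close>
     (\<forall>f\<in>F. L2fun M f) \<and>
     (\<forall>f\<in>F. \<forall>g. g \<in> borel_measurable M \<and> (AE x in M. f x = g x) \<longrightarrow> g \<in> F) \<and>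
     (\<forall>f\<in>F. \<forall>f'\<in>F. \<forall>g\<in>F. (AE x in M. f x = f' x) \<longrightarrow> E f g = E f' g) \<and>
     \<comment> \<open>symmetric nonnegative definite bilinear form on the linear subspace F\<close>
     bilinear_form F E \<and>
     \<comment> \<open>F is dense in L2\<close>
     (\<forall>u. L2fun M u \<longrightarrow> (\<forall>e>0. \<exists>f\<in>F. L2dist2 M u f < e)) \<and>
     \<comment> \<open>closedness: (F, E_1) is complete\<close>
     (\<forall>fs. (\<forall>n. fs n \<in> F) \<and> (\<forall>e>0. \<exists>N. \<forall>m\<ge>N. \<forall>n\<ge>N. E1 M E (fs n) (fs m) < e) \<longrightarrow>
        (\<exists>f\<in>F. (\<lambda>n. E1 M E (fs n) f) \<longlonglongrightarrow> 0)) \<and>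
     \<comment> \<open>Markov property: the unit contraction operates\<close>
     (\<forall>f\<in>F. (T1 \<circ> f) \<in> F \<and> E (T1 \<circ> f) (T1 \<circ> f) \<le> E f f)"

definition bdd_part :: "'a measure \<Rightarrow> 'a rfun set \<Rightarrow> 'a rfun set" where
  "bdd_part M F = {f. f \<in> borel_measurable M \<and> bounded (f ` space M) \<and> f \<in> F}"

end

theory Submission
  imports Defs
begin

text \<open>
  Let \<open>R\<^sub>\<alpha> = \<alpha> G\<^sub>\<alpha>\<close> be the resolvent, so that \<open>E(R\<^sub>\<alpha> u, v) = \<alpha> \<langle>u - R\<^sub>\<alpha> u, v\<rangle>\<close> tends to \<open>E(u, v)\<close>
  as \<open>\<alpha> \<rightarrow> \<infinity>\<close>.  Then \<open>L\<^sub>f(h)\<close> is the limit of \<open>\<alpha> \<integral> h \<Gamma>\<^sub>\<alpha>(f)\<close> with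
  \<open>\<Gamma>\<^sub>\<alpha>(f) = f\<^sup>2 - 2 f R\<^sub>\<alpha> f + R\<^sub>\<alpha>(f\<^sup>2)\<close>, and the sub-Markov property of \<open>R\<^sub>\<alpha>\<close> gives
  \<open>\<Gamma>\<^sub>\<alpha>(N \<circ> f) \<le> \<Gamma>\<^sub>\<alpha>(f)\<close> almost everywhere for every normal contraction \<open>N\<close>.  This yields the
  contraction properties of \<open>L\<close> and \<open>E\<close>, positivity (\<open>N = 0\<close>) and \<open>\<bar>L\<^sub>f(h)\<bar> \<le> 2 sup \<bar>h\<bar> E(f, f)\<close>.

  Closability rests on the identity \<open>L\<^bsub>f,g\<^esub>(h) + L\<^bsub>g,h\<^esub>(f) = 2 E(f h, g)\<close>.  If \<open>f\<^sub>n \<rightarrow> 0\<close> uniformly and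
  \<open>L\<^bsub>f\<^sub>n\<^esub>(h)\<close> is bounded, then \<open>L\<^bsub>g,h\<^esub>(f\<^sub>n) \<rightarrow> 0\<close>, while \<open>f\<^sub>n h\<close> is \<open>E\<close>-bounded and tends to zero in
  \<open>L\<^sub>2\<close>, hence \<open>E\<close>-weakly; so \<open>L\<^bsub>f\<^sub>n,g\<^esub>(h) \<rightarrow> 0\<close>.  In the same way
  \<open>E(f\<^sub>n, p c) = E(f\<^sub>n p, c) + E(f\<^sub>n c, p) - L\<^bsub>p,c\<^esub>(f\<^sub>n) \<rightarrow> 0\<close> if \<open>E(f\<^sub>n, f\<^sub>n)\<close> is bounded, and the
  products \<open>p c\<close> are \<open>E\<close>-dense.
\<close>

section \<open>Nonnegative symmetric bilinear forms\<close>

locale nonneg_form =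
  fixes D :: "'a rfun set" and Q :: "'a rfun \<Rightarrow> 'a rfun \<Rightarrow> real"
  assumes form: "bilinear_form D Q"
begin

lemma zero_in [simp, intro]: "(\<lambda>x. 0) \<in> D"
  using form unfolding bilinear_form_def lin_subspace_def by blast

lemma add_in [simp, intro]: "f \<in> D \<Longrightarrow> g \<in> D \<Longrightarrow> (\<lambda>x. f x + g x) \<in> D"
  using form unfolding bilinear_form_def lin_subspace_def by blast

lemma scale_in [simp, intro]: "f \<in> D \<Longrightarrow> (\<lambda>x. c * f x) \<in> D"
  using form unfolding bilinear_form_def lin_subspace_def by blast

lemma diff_in [simp, intro]: "f \<in> D \<Longrightarrow> g \<in> D \<Longrightarrow> (\<lambda>x. f x - g x) \<in> D"
  using add_in[OF _ scale_in[of g "-1"], of f] by simp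

lemma sym: "f \<in> D \<Longrightarrow> g \<in> D \<Longrightarrow> Q f g = Q g f"
  using form unfolding bilinear_form_def by blast

lemma nonneg [simp]: "f \<in> D \<Longrightarrow> 0 \<le> Q f f"
  using form unfolding bilinear_form_def by blast

lemma lin_left: "f \<in> D \<Longrightarrow> f' \<in> D \<Longrightarrow> g \<in> D \<Longrightarrow> Q (\<lambda>x. c * f x + f' x) g = c * Q f g + Q f' g"
  using form unfolding bilinear_form_def by blast

lemma add_left: "f \<in> D \<Longrightarrow> f' \<in> D \<Longrightarrow> g \<in> D \<Longrightarrow> Q (\<lambda>x. f x + f' x) g = Q f g + Q f' g"
  using lin_left[of f f' g 1] by simp

lemma diff_left: "f \<in> D \<Longrightarrow> f' \<in> D \<Longrightarrow> g \<in> D \<Longrightarrow> Q (\<lambda>x. f x - f' x) g = Q f g - Q f' g"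
  using lin_left[of f' f g "-1"] by simp

lemma zero_left [simp]: "g \<in> D \<Longrightarrow> Q (\<lambda>x. 0) g = 0"
  using diff_left[of g g g] by simp

lemma scale_left: "f \<in> D \<Longrightarrow> g \<in> D \<Longrightarrow> Q (\<lambda>x. c * f x) g = c * Q f g"
  using lin_left[of f "\<lambda>x. 0" g c] by simp

lemma add_right: "f \<in> D \<Longrightarrow> f' \<in> D \<Longrightarrow> g \<in> D \<Longrightarrow> Q g (\<lambda>x. f x + f' x) = Q g f + Q g f'"
  using add_left[of f f' g] sym[of g "\<lambda>x. f x + f' x"] sym[of f g] sym[of f' g] by simp

lemma diff_right: "f \<in> D \<Longrightarrow> f' \<in> D \<Longrightarrow> g \<in> D \<Longrightarrow> Q g (\<lambda>x. f x - f' x) = Q g f - Q g f'"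
  using diff_left[of f f' g] sym[of g "\<lambda>x. f x - f' x"] sym[of f g] sym[of f' g] by simp

lemma scale_right: "f \<in> D \<Longrightarrow> g \<in> D \<Longrightarrow> Q g (\<lambda>x. c * f x) = c * Q g f"
  using scale_left[of f g c] sym[of g "\<lambda>x. c * f x"] sym[of f g] by simp

lemma zero_right [simp]: "g \<in> D \<Longrightarrow> Q g (\<lambda>x. 0) = 0"
  using zero_left[of g] sym[of g "\<lambda>x. 0"] by simp

lemmas expand = add_left diff_left scale_left add_right diff_right scale_right

lemma diff_self: "f \<in> D \<Longrightarrow> g \<in> D \<Longrightarrow>
    Q (\<lambda>x. f x - g x) (\<lambda>x. f x - g x) = Q f f - 2 * Q f g + Q g g"
  by (simp add: expand sym[of g f])

lemma add_self: "f \<in> D \<Longrightarrow> g \<in> D \<Longrightarrow>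
    Q (\<lambda>x. f x + g x) (\<lambda>x. f x + g x) = Q f f + 2 * Q f g + Q g g"
  by (simp add: expand sym[of g f])

lemma arith_geo_mean:
  assumes "f \<in> D" "g \<in> D"
  shows "2 * \<bar>Q f g\<bar> \<le> Q f f + Q g g"
proof -
  have "0 \<le> Q f f - 2 * Q f g + Q g g" "0 \<le> Q f f + 2 * Q f g + Q g g"
    using nonneg[OF diff_in[OF assms]] nonneg[OF add_in[OF assms]] diff_self add_self assms by auto
  then show ?thesis by linarith
qed

text \<open>The unweighted inequality for \<open>c * f\<close> and \<open>g\<close>, divided by
  \<open>c\<close>. The free weight makes it possible to absorb one term into the other side of an
  estimate.\<close>

lemma arith_geo_mean_weighted:
  assumes "f \<in> D" "g \<in> D" "c > 0"
  shows "2 * \<bar>Q f g\<bar> \<le> c * Q f f + Q g g / c"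
proof -
  have "2 * \<bar>Q (\<lambda>x. c * f x) g\<bar> \<le> Q (\<lambda>x. c * f x) (\<lambda>x. c * f x) + Q g g"
    by (rule arith_geo_mean) (use assms in auto)
  then have "c * (2 * \<bar>Q f g\<bar>) \<le> c * (c * Q f f) + Q g g"
    using assms by (simp add: expand abs_mult)
  also have "\<dots> = c * (c * Q f f + Q g g / c)"
    using assms(3) by (simp add: distrib_left)
  finally show ?thesis using assms(3) by simp
qed

lemma add_self_le:
  assumes "f \<in> D" "g \<in> D"
  shows "Q (\<lambda>x. f x + g x) (\<lambda>x. f x + g x) \<le> 2 * Q f f + 2 * Q g g"
  using arith_geo_mean[OF assms] add_self[OF assms] by linarith

text \<open>The first-order condition at a minimum: in the Riesz argument \<open>d\<close> is half
  the directional derivative of the functional and \<open>q\<close> the square of the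
  direction.\<close>

lemma nonneg_quadratic_imp_zero:
  fixes d q :: real
  assumes "\<And>t. 0 \<le> 2 * t * d + t\<^sup>2 * q" "q \<ge> 0"
  shows "d = 0"
proof -
  have p: "q + 1 > 0" using assms by simp
  \<comment> \<open>This minimizes the quadratic with \<open>q\<close> enlarged to
    \<open>q + 1\<close>, which keeps the denominator positive when \<open>q = 0\<close>.\<close>
  define t where "t = - d / (q + 1)"
  have t: "(q + 1) * t = - d" unfolding t_def using p by simp
  have "0 \<le> (q + 1)\<^sup>2 * (2 * t * d + t\<^sup>2 * q)"
    using assms(1)[of t] by (intro mult_nonneg_nonneg) auto
  also have "\<dots> = 2 * ((q + 1) * t) * d * (q + 1) + ((q + 1) * t)\<^sup>2 * q"
    by (simp add: algebra_simps power2_eq_square)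
  also have "\<dots> = - (d\<^sup>2 * (q + 2))"
    unfolding t by (simp add: algebra_simps power2_eq_square)
  finally have "d\<^sup>2 * (q + 2) \<le> 0" by simp
  then have "d\<^sup>2 \<le> 0" using assms(2) by (simp add: mult_le_0_iff)
  then show ?thesis by simp
qed

lemma cauchy_schwarz:
  assumes "f \<in> D" "g \<in> D"
  shows "(Q f g)\<^sup>2 \<le> Q f f * Q g g"
proof (cases "Q g g = 0")
  case True
  have "Q f g = 0"
  proof (rule ccontr)
    assume nz: "Q f g \<noteq> 0"
    \<comment> \<open>The form may be degenerate, so \<open>g\<close> need not be zero here. This
      \<open>t\<close> makes the square below equal to -1.\<close>
    define t where "t = (Q f f + 1) / (2 * Q f g)"
    have "0 \<le> Q (\<lambda>x. f x - t * g x) (\<lambda>x. f x - t * g x)"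
      using assms by (intro nonneg diff_in scale_in)
    also have "\<dots> = Q f f - 2 * t * Q f g"
      using assms True by (simp add: expand sym[of g f] algebra_simps)
    finally show False using nz by (simp add: t_def)
  qed
  then show ?thesis using True by simp
next
  case False
  define t where "t = Q f g / Q g g"
  have p: "Q g g > 0" using False nonneg[OF assms(2)] by linarith
  have "0 \<le> Q (\<lambda>x. f x - t * g x) (\<lambda>x. f x - t * g x)"
    using assms by (intro nonneg diff_in scale_in)
  also have "\<dots> = Q f f - 2 * t * Q f g + t\<^sup>2 * Q g g"
    using assms by (simp add: expand sym[of g f] power2_eq_square algebra_simps)
  also have "\<dots> = Q f f - (Q f g)\<^sup>2 / Q g g"
    using p unfolding t_def by (simp add: field_simps power2_eq_square)
  finally show ?thesis using p by (simp add: field_simps)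
qed

lemma tendsto_form_left:
  assumes "\<And>n. fs n \<in> D" "f \<in> D" "g \<in> D"
    and lim: "(\<lambda>n. Q (\<lambda>x. fs n x - f x) (\<lambda>x. fs n x - f x)) \<longlonglongrightarrow> 0"
  shows "(\<lambda>n. Q (fs n) g) \<longlonglongrightarrow> Q f g"
proof -
  have "(\<lambda>n. sqrt (Q (\<lambda>x. fs n x - f x) (\<lambda>x. fs n x - f x) * Q g g)) \<longlonglongrightarrow> sqrt (0 * Q g g)"
    by (intro tendsto_intros lim)
  moreover have "norm (Q (fs n) g - Q f g) \<le> sqrt (Q (\<lambda>x. fs n x - f x) (\<lambda>x. fs n x - f x) * Q g g)" for n
  proof -
    have "Q (fs n) g - Q f g = Q (\<lambda>x. fs n x - f x) g" using assms by (simp add: expand)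
    moreover have "(Q (\<lambda>x. fs n x - f x) g)\<^sup>2 \<le> Q (\<lambda>x. fs n x - f x) (\<lambda>x. fs n x - f x) * Q g g"
      using assms by (intro cauchy_schwarz) auto
    ultimately show ?thesis by (simp add: real_le_rsqrt)
  qed
  ultimately have "(\<lambda>n. Q (fs n) g - Q f g) \<longlonglongrightarrow> 0"
    by (intro Lim_null_comparison[of "\<lambda>n. Q (fs n) g - Q f g"]) auto
  then show ?thesis by (simp add: LIM_zero_iff)
qed

text \<open>Direct method: \<open>J v = Q v v - 2 * l v\<close> is bounded below, the parallelogram
  identity makes a minimizing sequence Cauchy, and the first-order condition at its limit is the
  claim. Since \<open>Q\<close> may be degenerate, \<open>r\<close> is not claimed to be
  unique.\<close>

lemma riesz_representation:
  assumes complete: "\<And>fs. (\<forall>n. fs n \<in> D) \<Longrightarrow> form_cauchy Q fs \<Longrightarrow>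
      \<exists>f\<in>D. (\<lambda>n. Q (\<lambda>x. fs n x - f x) (\<lambda>x. fs n x - f x)) \<longlonglongrightarrow> 0"
    and lin: "\<And>c f g. f \<in> D \<Longrightarrow> g \<in> D \<Longrightarrow> l (\<lambda>x. c * f x + g x) = c * l f + l g"
    and bound: "\<And>f. f \<in> D \<Longrightarrow> (l f)\<^sup>2 \<le> C * Q f f" and "C \<ge> 0"
  shows "\<exists>r\<in>D. \<forall>w\<in>D. Q r w = l w"
proof -
  define J where "J v = Q v v - 2 * l v" for v
  define m where "m = Inf (J ` D)"
  have "- C \<le> J v" if "v \<in> D" for v
  proof -
    have "(l v)\<^sup>2 \<le> C * Q v v" by (rule bound[OF that])
    \<comment> \<open>The added square completes \<open>C * Q v v\<close> to the square of the mean
      of \<open>C\<close> and \<open>Q v v\<close>.\<close>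
    also have "\<dots> \<le> C * Q v v + ((C - Q v v) / 2)\<^sup>2" by simp
    also have "\<dots> = ((C + Q v v) / 2)\<^sup>2" by (simp add: power2_eq_square field_simps)
    finally have "\<bar>l v\<bar> \<le> (C + Q v v) / 2"
      using abs_le_square_iff[of "l v" "(C + Q v v) / 2"] \<open>C \<ge> 0\<close> nonneg[OF that] by simp
    then show ?thesis unfolding J_def using abs_ge_self[of "l v"] by (simp add: field_simps)
  qed
  then have bdd: "bdd_below (J ` D)" by (intro bdd_belowI[of _ "- C"]) auto
  have m_le: "m \<le> J v" if "v \<in> D" for v
    unfolding m_def using bdd that by (intro cInf_lower) auto
  have "\<exists>v\<in>D. J v < m + inverse (real (Suc n))" for n
  proof -
    have "m < m + inverse (real (Suc n))" by simp
    then obtain y where "y \<in> J ` D" "y < m + inverse (real (Suc n))"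
      unfolding m_def using cInf_lessD[of "J ` D"] zero_in by blast
    then show ?thesis by blast
  qed
  then obtain v where v: "\<And>n. v n \<in> D" "\<And>n. J (v n) < m + inverse (real (Suc n))"
    by metis
  have J_shift: "J (\<lambda>x. t * w x + u x) = J u + 2 * t * (Q u w - l w) + t\<^sup>2 * Q w w"
    if "u \<in> D" "w \<in> D" for t u w
  proof -
    have "l (\<lambda>x. t * w x + u x) = t * l w + l u" using that by (intro lin)
    then show ?thesis unfolding J_def using that
      by (simp add: expand sym[of w u] algebra_simps power2_eq_square)
  qed
  have close: "Q (\<lambda>x. v n x - v k x) (\<lambda>x. v n x - v k x)
      \<le> 2 * inverse (real (Suc n)) + 2 * inverse (real (Suc k))" for n k
  proof -
    \<comment> \<open>The midpoint of \<open>v n\<close> and \<open>v k\<close> also has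
      \<open>J\<close> at least \<open>m\<close>. Twice this inequality, compared with the two
      near-minimal values at the endpoints, leaves half of \<open>Q d d\<close>.\<close>
    define d where "d = (\<lambda>x. v k x - v n x)"
    have d: "d \<in> D" unfolding d_def using v by auto
    have "m \<le> J (\<lambda>x. (1/2) * d x + v n x)" using d v by (intro m_le add_in scale_in)
    then have 1: "m \<le> J (v n) + (Q (v n) d - l d) + Q d d / 4"
      using J_shift[OF v(1) d, of "1/2" n] by (simp add: power2_eq_square)
    have "J (v k) = J (\<lambda>x. 1 * d x + v n x)" unfolding d_def by simp
    then have 2: "J (v k) = J (v n) + 2 * (Q (v n) d - l d) + Q d d"
      using J_shift[OF v(1) d, of 1 n] by simp
    have "Q (\<lambda>x. v n x - v k x) (\<lambda>x. v n x - v k x) = Q d d"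
      unfolding d_def using v by (simp add: diff_self sym[of "v k" "v n"])
    then show ?thesis using 1 2 v(2)[of n] v(2)[of k] by argo
  qed
  have "form_cauchy Q v"
    unfolding form_cauchy_def
  proof (intro allI impI)
    fix e :: real assume "e > 0"
    then obtain N where N: "inverse (real (Suc N)) < e / 4"
      using reals_Archimedean[of "e / 4"] by auto
    have small: "inverse (real (Suc n)) < e / 4" if "n \<ge> N" for n
      by (rule le_less_trans[OF le_imp_inverse_le N]) (use that in auto)
    have "Q (\<lambda>x. v n x - v m x) (\<lambda>x. v n x - v m x) < e" if "m \<ge> N" "n \<ge> N" for m n
      using close[of n m] small[OF that(1)] small[OF that(2)] by linarith
    then show "\<exists>N. \<forall>m\<ge>N. \<forall>n\<ge>N. Q (\<lambda>x. v n x - v m x) (\<lambda>x. v n x - v m x) < e"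
      by blast
  qed
  then obtain r where r: "r \<in> D" "(\<lambda>n. Q (\<lambda>x. v n x - r x) (\<lambda>x. v n x - r x)) \<longlonglongrightarrow> 0"
    using complete v(1) by blast
  have "Q r w = l w" if w: "w \<in> D" for w
  proof -
    have "Q r w - l w = 0"
    proof (rule nonneg_quadratic_imp_zero)
      fix t
      \<comment> \<open>For fixed \<open>t\<close>, near-minimality of \<open>v n\<close> gives the
        quadratic inequality up to \<open>inverse (real (Suc n))\<close>, and the inequality itself
        is passed to the limit.\<close>
      have lim: "(\<lambda>n. inverse (real (Suc n)) + 2 * t * (Q (v n) w - l w) + t\<^sup>2 * Q w w)
          \<longlonglongrightarrow> 0 + 2 * t * (Q r w - l w) + t\<^sup>2 * Q w w"
        by (intro tendsto_intros LIMSEQ_inverse_real_of_nat tendsto_form_left v r w)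
      have "0 \<le> inverse (real (Suc n)) + 2 * t * (Q (v n) w - l w) + t\<^sup>2 * Q w w" for n
      proof -
        have "m \<le> J (\<lambda>x. t * w x + v n x)" using w v by (intro m_le add_in scale_in)
        then show ?thesis using J_shift[OF v(1) w, of t n] v(2)[of n] by linarith
      qed
      then have "0 \<le> 0 + 2 * t * (Q r w - l w) + t\<^sup>2 * Q w w"
        by (intro LIMSEQ_le_const[OF lim]) auto
      then show "0 \<le> 2 * t * (Q r w - l w) + t\<^sup>2 * Q w w" by simp
    qed (use w in auto)
    then show ?thesis by simp
  qed
  then show ?thesis using r(1) by blast
qed

section \<open>Boundedness and convergence to zero of form-Cauchy sequences\<close>

lemma form_cauchy_bounded:
  assumes "\<And>n. fs n \<in> D" "form_cauchy Q fs"
  obtains C N where "\<And>n. n \<ge> N \<Longrightarrow> Q (fs n) (fs n) \<le> C"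
proof -
  obtain N where N: "\<And>m n. m \<ge> N \<Longrightarrow> n \<ge> N \<Longrightarrow> Q (\<lambda>x. fs n x - fs m x) (\<lambda>x. fs n x - fs m x) < 1"
    using assms(2) unfolding form_cauchy_def by (meson zero_less_one)
  have "Q (fs n) (fs n) \<le> 2 * 1 + 2 * Q (fs N) (fs N)" if "n \<ge> N" for n
    using add_self_le[of "\<lambda>x. fs n x - fs N x" "fs N"] N[of N n] that assms(1) by fastforce
  then show ?thesis using that by blast
qed

text \<open>In the expansion of the square of \<open>fs n - fs m\<close> the term
  \<open>Q (fs n) (fs n)\<close> is dropped and \<open>n\<close> tends to infinity at fixed
  \<open>m\<close>, which removes the mixed term. Closability is thus reduced to weak convergence
  tested against the members of the sequence.\<close>

lemma tendsto_zero_of_form_cauchy: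
  assumes fs: "\<And>n. fs n \<in> D" and "form_cauchy Q fs"
    and weak: "\<And>m. (\<lambda>n. Q (fs n) (fs m)) \<longlonglongrightarrow> 0"
  shows "(\<lambda>n. Q (fs n) (fs n)) \<longlonglongrightarrow> 0"
proof (rule LIMSEQ_I)
  fix e :: real assume "e > 0"
  then obtain N where N: "\<And>m n. m \<ge> N \<Longrightarrow> n \<ge> N \<Longrightarrow>
      Q (\<lambda>x. fs n x - fs m x) (\<lambda>x. fs n x - fs m x) < e / 2"
    using assms(2) unfolding form_cauchy_def by (meson half_gt_zero)
  have "Q (fs m) (fs m) \<le> e / 2" if "m \<ge> N" for m
  proof -
    have lim: "(\<lambda>n. e / 2 + 2 * Q (fs n) (fs m)) \<longlonglongrightarrow> e / 2 + 2 * 0"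
      by (intro tendsto_intros weak)
    have "\<forall>n\<ge>N. Q (fs m) (fs m) \<le> e / 2 + 2 * Q (fs n) (fs m)"
    proof (intro allI impI)
      fix n assume "n \<ge> N"
      then have "Q (fs n) (fs n) - 2 * Q (fs n) (fs m) + Q (fs m) (fs m) < e / 2"
        using N[OF that] diff_self[OF fs fs] by simp
      then show "Q (fs m) (fs m) \<le> e / 2 + 2 * Q (fs n) (fs m)"
        using nonneg[OF fs, of n] by linarith
    qed
    then have "Q (fs m) (fs m) \<le> e / 2 + 2 * 0"
      by (intro LIMSEQ_le_const[OF lim]) auto
    then show ?thesis by simp
  qed
  then have "norm (Q (fs n) (fs n) - 0) < e" if "n \<ge> N" for n
    using \<open>e > 0\<close> nonneg[OF fs, of n] that by fastforce
  then show "\<exists>N. \<forall>n\<ge>N. norm (Q (fs n) (fs n) - 0) < e" by blast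
qed

text \<open>For an eventually bounded sequence the pairing with \<open>w\<close> is controlled, by
  Cauchy-Schwarz, by the pairing with a test function near \<open>w\<close>.\<close>

lemma tendsto_zero_of_approximations:
  assumes v: "\<And>n. v n \<in> D" and C: "\<forall>\<^sub>F n in sequentially. Q (v n) (v n) \<le> C" and w: "w \<in> D"
    and approx: "\<And>e. e > 0 \<Longrightarrow>
      \<exists>r\<in>D. Q (\<lambda>x. r x - w x) (\<lambda>x. r x - w x) < e \<and> (\<lambda>n. Q (v n) r) \<longlonglongrightarrow> 0"
  shows "(\<lambda>n. Q (v n) w) \<longlonglongrightarrow> 0"
proof (rule LIMSEQ_I)
  fix e :: real assume "e > 0"
  define K where "K = \<bar>C\<bar> + 1"
  have K: "K > 0" unfolding K_def by simp
  \<comment> \<open>This tolerance makes the Cauchy-Schwarz error at most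
    \<open>e / 2\<close>.\<close>
  then have "e\<^sup>2 / (4 * K) > 0" using \<open>e > 0\<close> by simp
  then obtain r where r: "r \<in> D" "Q (\<lambda>x. r x - w x) (\<lambda>x. r x - w x) < e\<^sup>2 / (4 * K)"
      "(\<lambda>n. Q (v n) r) \<longlonglongrightarrow> 0"
    using approx by blast
  from r(3) have "\<forall>\<^sub>F n in sequentially. norm (Q (v n) r - 0) < e / 2"
    unfolding dist_norm[symmetric] by (rule tendstoD) (use \<open>e > 0\<close> in simp)
  then have "\<forall>\<^sub>F n in sequentially. norm (Q (v n) w - 0) < e"
    using C
  proof eventually_elim
    case (elim n)
    have d: "(\<lambda>x. r x - w x) \<in> D" using r w by auto
    have "(Q (v n) (\<lambda>x. r x - w x))\<^sup>2 \<le> Q (v n) (v n) * Q (\<lambda>x. r x - w x) (\<lambda>x. r x - w x)"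
      by (rule cauchy_schwarz[OF v d])
    also have "\<dots> \<le> K * (e\<^sup>2 / (4 * K))"
      using r(2) elim(2) nonneg[OF d] unfolding K_def by (intro mult_mono) auto
    also have "\<dots> = (e / 2)\<^sup>2" using K by (simp add: power2_eq_square)
    finally have "\<bar>Q (v n) (\<lambda>x. r x - w x)\<bar> \<le> e / 2"
      using abs_le_square_iff[of _ "e / 2"] \<open>e > 0\<close> by simp
    moreover have "Q (v n) (\<lambda>x. r x - w x) = Q (v n) r - Q (v n) w"
      using v r w by (intro diff_right) auto
    ultimately show ?case using elim(1) unfolding real_norm_def by linarith
  qed
  then show "\<exists>N. \<forall>n\<ge>N. norm (Q (v n) w - 0) < e" unfolding eventually_sequentially .
qed

end

section \<open>Square-integrable functions\<close>

definition ip :: "'a measure \<Rightarrow> 'a rfun \<Rightarrow> 'a rfun \<Rightarrow> real" where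
  "ip M f g = (\<integral>x. f x * g x \<partial>M)"

lemma L2fun_measurable [measurable_dest]: "L2fun M f \<Longrightarrow> f \<in> borel_measurable M"
  unfolding L2fun_def by simp

lemma L2fun_integrable_mult [simp, intro]:
  assumes "L2fun M f" "L2fun M g"
  shows "integrable M (\<lambda>x. f x * g x)"
proof (rule Bochner_Integration.integrable_bound)
  show "integrable M (\<lambda>x. (f x)\<^sup>2 + (g x)\<^sup>2)" using assms unfolding L2fun_def by auto
  show "(\<lambda>x. f x * g x) \<in> borel_measurable M" using assms unfolding L2fun_def by auto
  show "AE x in M. norm (f x * g x) \<le> norm ((f x)\<^sup>2 + (g x)\<^sup>2)"
  proof (intro AE_I2)
    fix x
    have "2 * (\<bar>f x\<bar> * \<bar>g x\<bar>) \<le> (f x)\<^sup>2 + (g x)\<^sup>2" "0 \<le> \<bar>f x\<bar> * \<bar>g x\<bar>"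
      using sum_squares_bound[of "\<bar>f x\<bar>" "\<bar>g x\<bar>"] by (auto simp: mult.assoc)
    then have "\<bar>f x\<bar> * \<bar>g x\<bar> \<le> (f x)\<^sup>2 + (g x)\<^sup>2" by linarith
    then show "norm (f x * g x) \<le> norm ((f x)\<^sup>2 + (g x)\<^sup>2)" by (simp add: abs_mult)
  qed
qed

lemma L2fun_dominated:
  assumes "L2fun M f" "g \<in> borel_measurable M" "\<And>x. x \<in> space M \<Longrightarrow> \<bar>g x\<bar> \<le> K * \<bar>f x\<bar>"
  shows "L2fun M g"
  unfolding L2fun_def
proof
  show "integrable M (\<lambda>x. (g x)\<^sup>2)"
  proof (rule Bochner_Integration.integrable_bound)
    show "integrable M (\<lambda>x. K\<^sup>2 * (f x)\<^sup>2)" using assms(1) unfolding L2fun_def by simp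
    show "(\<lambda>x. (g x)\<^sup>2) \<in> borel_measurable M" using assms by simp
    show "AE x in M. norm ((g x)\<^sup>2) \<le> norm (K\<^sup>2 * (f x)\<^sup>2)"
    proof (intro AE_I2)
      fix x assume "x \<in> space M"
      then have "\<bar>g x\<bar>\<^sup>2 \<le> (K * \<bar>f x\<bar>)\<^sup>2" using assms(3) by (intro power_mono) auto
      then show "norm ((g x)\<^sup>2) \<le> norm (K\<^sup>2 * (f x)\<^sup>2)" by (simp add: power_mult_distrib)
    qed
  qed
qed (rule assms)

lemma L2fun_zero [simp]: "L2fun M (\<lambda>x. 0)"
  unfolding L2fun_def by simp

lemma L2fun_add [simp, intro]:
  assumes "L2fun M f" "L2fun M g"
  shows "L2fun M (\<lambda>x. f x + g x)"
proof -
  have "integrable M (\<lambda>x. (f x)\<^sup>2 + 2 * (f x * g x) + (g x)\<^sup>2)"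
    using assms by (auto simp: L2fun_def)
  moreover have "(\<lambda>x. (f x)\<^sup>2 + 2 * (f x * g x) + (g x)\<^sup>2) = (\<lambda>x. (f x + g x)\<^sup>2)"
    by (auto simp: power2_eq_square algebra_simps)
  ultimately show ?thesis using assms by (auto simp: L2fun_def)
qed

lemma L2fun_scale [simp, intro]: "L2fun M f \<Longrightarrow> L2fun M (\<lambda>x. c * f x)"
  unfolding L2fun_def by (auto simp: power_mult_distrib)

lemma L2fun_mult_bounded:
  assumes "L2fun M f" "g \<in> borel_measurable M" "\<And>x. x \<in> space M \<Longrightarrow> \<bar>g x\<bar> \<le> K"
  shows "L2fun M (\<lambda>x. g x * f x)" "L2fun M (\<lambda>x. f x * g x)"
proof -
  show "L2fun M (\<lambda>x. g x * f x)"
    by (rule L2fun_dominated[OF assms(1), where K = K])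
       (use assms in \<open>auto simp: abs_mult intro!: mult_right_mono borel_measurable_times L2fun_measurable\<close>)
  then show "L2fun M (\<lambda>x. f x * g x)" by (simp add: mult.commute)
qed

lemma ip_commute: "ip M f g = ip M g f"
  unfolding ip_def by (simp add: mult.commute)

lemma nonneg_form_ip: "nonneg_form {f. L2fun M f} (ip M)"
proof
  have lin: "ip M (\<lambda>x. c * f x + f' x) g = c * ip M f g + ip M f' g"
    if "L2fun M f" "L2fun M f'" "L2fun M g" for c f f' g
  proof -
    have "ip M (\<lambda>x. c * f x + f' x) g = (\<integral>x. c * (f x * g x) + f' x * g x \<partial>M)"
      unfolding ip_def by (simp add: algebra_simps)
    also have "\<dots> = c * ip M f g + ip M f' g"
      unfolding ip_def using that by (subst Bochner_Integration.integral_add) auto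
    finally show ?thesis .
  qed
  show "bilinear_form {f. L2fun M f} (ip M)"
    unfolding bilinear_form_def lin_subspace_def using lin
    by (auto simp: ip_commute) (auto simp: ip_def)
qed

lemma ip_self_zero:
  assumes "L2fun M f" "ip M f f = 0"
  shows "AE x in M. f x = 0"
  using assms integral_nonneg_eq_0_iff_AE[of M "\<lambda>x. f x * f x"]
  unfolding ip_def by auto

section \<open>The resolvent of a Dirichlet form\<close>

locale dirichlet = sigma_finite_measure M for M :: "'a measure" +
  fixes F :: "'a rfun set" and E :: "'a rfun \<Rightarrow> 'a rfun \<Rightarrow> real"
  assumes dirichlet: "dirichlet_form M F E"
begin

sublocale L2: nonneg_form "{f. L2fun M f}" "ip M"
  by (rule nonneg_form_ip)

sublocale E: nonneg_form F E
proof
  show "bilinear_form F E" using dirichlet unfolding dirichlet_form_def by (elim conjE)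
qed

lemma in_L2 [simp, intro]: "f \<in> F \<Longrightarrow> L2fun M f"
  using dirichlet[unfolded dirichlet_form_def, THEN conjunct1] by blast

lemma in_measurable [simp, intro]: "f \<in> F \<Longrightarrow> f \<in> borel_measurable M"
  using L2fun_measurable in_L2 by blast

lemma AE_in: "f \<in> F \<Longrightarrow> g \<in> borel_measurable M \<Longrightarrow> AE x in M. f x = g x \<Longrightarrow> g \<in> F"
  using dirichlet[unfolded dirichlet_form_def, THEN conjunct2, THEN conjunct1] by blast

lemma E_AE_cong_left: "f \<in> F \<Longrightarrow> f' \<in> F \<Longrightarrow> g \<in> F \<Longrightarrow> AE x in M. f x = f' x \<Longrightarrow> E f g = E f' g"
  using dirichlet[unfolded dirichlet_form_def, THEN conjunct2, THEN conjunct2, THEN conjunct1] by blast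

lemma E_AE_cong:
  assumes "f \<in> F" "f' \<in> F" "AE x in M. f x = f' x"
  shows "E f f = E f' f'"
  using E_AE_cong_left[OF assms(1,2,1,3)] E_AE_cong_left[OF assms(1,2,2,3)] E.sym[OF assms(1,2)]
  by linarith

lemma unit_contraction:
  assumes "f \<in> F"
  shows "(T1 \<circ> f) \<in> F" "E (T1 \<circ> f) (T1 \<circ> f) \<le> E f f"
proof -
  have "\<forall>f\<in>F. (T1 \<circ> f) \<in> F \<and> E (T1 \<circ> f) (T1 \<circ> f) \<le> E f f"
    using dirichlet unfolding dirichlet_form_def by (elim conjE)
  then show "(T1 \<circ> f) \<in> F" "E (T1 \<circ> f) (T1 \<circ> f) \<le> E f f" using assms by auto
qed

text \<open>The form usually written \<open>E\<^sub>\<alpha>\<close>; for \<alpha> = 1 it is the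
  square of the norm in which the domain is complete.\<close>

definition shifted :: "real \<Rightarrow> 'a rfun \<Rightarrow> 'a rfun \<Rightarrow> real" where
  "shifted \<alpha> f g = E f g + \<alpha> * ip M f g"

lemma E1_eq_shifted: "E1 M E f g = shifted 1 (\<lambda>x. f x - g x) (\<lambda>x. f x - g x)"
  unfolding E1_def L2dist2_def shifted_def ip_def by (simp add: power2_eq_square)

lemma complete:
  assumes "\<And>n. fs n \<in> F" "form_cauchy (shifted 1) fs"
  shows "\<exists>f\<in>F. (\<lambda>n. shifted 1 (\<lambda>x. fs n x - f x) (\<lambda>x. fs n x - f x)) \<longlonglongrightarrow> 0"
proof -
  have "(\<forall>n. fs n \<in> F) \<and> (\<forall>e>0. \<exists>N. \<forall>m\<ge>N. \<forall>n\<ge>N. E1 M E (fs n) (fs m) < e)"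
    using assms unfolding E1_eq_shifted form_cauchy_def by blast
  then have "\<exists>f\<in>F. (\<lambda>n. E1 M E (fs n) f) \<longlonglongrightarrow> 0"
    using dirichlet[unfolded dirichlet_form_def, THEN conjunct2, THEN conjunct2, THEN conjunct2,
        THEN conjunct2, THEN conjunct2, THEN conjunct1] by blast
  then show ?thesis unfolding E1_eq_shifted .
qed

lemma nonneg_form_shifted:
  assumes "\<alpha> \<ge> 0"
  shows "nonneg_form F (shifted \<alpha>)"
proof
  have "lin_subspace F" using E.form unfolding bilinear_form_def by blast
  then show "bilinear_form F (shifted \<alpha>)"
    unfolding bilinear_form_def
  proof (intro conjI ballI allI)
    show "shifted \<alpha> f g = shifted \<alpha> g f" if "f \<in> F" "g \<in> F" for f g
      using E.sym[OF that] ip_commute[of M f g] unfolding shifted_def by simp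
    show "shifted \<alpha> (\<lambda>x. c * f x + f' x) g = c * shifted \<alpha> f g + shifted \<alpha> f' g"
      if "f \<in> F" "f' \<in> F" "g \<in> F" for c f f' g
      using that unfolding shifted_def
      by (simp add: E.lin_left L2.lin_left distrib_left mult.left_commute)
    show "0 \<le> shifted \<alpha> f f" if "f \<in> F" for f
      using that assms L2.nonneg[of f] unfolding shifted_def by simp
  qed
qed

text \<open>Riesz representation of \<alpha> times the pairing with \<open>u\<close> in the form
  \<open>shifted \<alpha>\<close>. Completeness carries over from \<open>shifted 1\<close>, because
  for \<alpha> \<ge> 1 the form lies between \<open>shifted 1\<close> and \<alpha> times it.\<close>

lemma resolvent_exists:
  assumes "\<alpha> \<ge> 1" "L2fun M u"
  shows "\<exists>r\<in>F. \<forall>v\<in>F. shifted \<alpha> r v = \<alpha> * ip M u v"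
proof -
  interpret S: nonneg_form F "shifted \<alpha>" using assms by (intro nonneg_form_shifted) simp
  have le: "shifted 1 v v \<le> shifted \<alpha> v v" "shifted \<alpha> v v \<le> \<alpha> * shifted 1 v v"
    if "v \<in> F" for v
    using assms(1) L2.nonneg[of v] E.nonneg[OF that] that
      mult_right_mono[of 1 \<alpha> "ip M v v"] mult_right_mono[of 1 \<alpha> "E v v"]
    unfolding shifted_def by (auto simp: algebra_simps)
  show ?thesis
  proof (rule S.riesz_representation)
    fix fs assume fs: "\<forall>n. fs n \<in> F" "form_cauchy (shifted \<alpha>) fs"
    have "form_cauchy (shifted 1) fs"
      unfolding form_cauchy_def
    proof (intro allI impI)
      fix e :: real assume "e > 0"
      then obtain N where N: "\<And>m n. m \<ge> N \<Longrightarrow> n \<ge> N \<Longrightarrow>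
          shifted \<alpha> (\<lambda>x. fs n x - fs m x) (\<lambda>x. fs n x - fs m x) < e"
        using fs(2) unfolding form_cauchy_def by meson
      have "shifted 1 (\<lambda>x. fs n x - fs m x) (\<lambda>x. fs n x - fs m x) < e"
        if "m \<ge> N" "n \<ge> N" for m n
        using le(1)[OF E.diff_in[of "fs n" "fs m"]] fs(1) N[OF that] by simp
      then show "\<exists>N. \<forall>m\<ge>N. \<forall>n\<ge>N. shifted 1 (\<lambda>x. fs n x - fs m x) (\<lambda>x. fs n x - fs m x) < e"
        by blast
    qed
    then obtain f where f: "f \<in> F" "(\<lambda>n. shifted 1 (\<lambda>x. fs n x - f x) (\<lambda>x. fs n x - f x)) \<longlonglongrightarrow> 0"
      using complete fs(1) by blast
    have lim: "(\<lambda>n. \<alpha> * shifted 1 (\<lambda>x. fs n x - f x) (\<lambda>x. fs n x - f x)) \<longlonglongrightarrow> 0"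
      using tendsto_mult[OF tendsto_const[of \<alpha>] f(2)] by simp
    have d: "(\<lambda>x. fs n x - f x) \<in> F" for n using fs(1) f(1) by auto
    have "(\<lambda>n. shifted \<alpha> (\<lambda>x. fs n x - f x) (\<lambda>x. fs n x - f x)) \<longlonglongrightarrow> 0"
      by (rule tendsto_sandwich[OF always_eventually always_eventually tendsto_const lim])
         (use S.nonneg[OF d] le(2)[OF d] in blast)+
    then show "\<exists>f\<in>F. (\<lambda>n. shifted \<alpha> (\<lambda>x. fs n x - f x) (\<lambda>x. fs n x - f x)) \<longlonglongrightarrow> 0"
      using f(1) by blast
  next
    fix c f g assume "f \<in> F" "g \<in> F"
    then show "\<alpha> * ip M u (\<lambda>x. c * f x + g x) = c * (\<alpha> * ip M u f) + \<alpha> * ip M u g"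
      using assms by (simp add: L2.expand distrib_left mult.left_commute)
  next
    fix f assume f: "f \<in> F"
    have "(\<alpha> * ip M u f)\<^sup>2 \<le> \<alpha>\<^sup>2 * (ip M u u * ip M f f)"
      using L2.cauchy_schwarz[of u f] assms f by (simp add: power_mult_distrib mult_left_mono)
    also have "\<dots> = \<alpha> * ip M u u * (\<alpha> * ip M f f)" by (simp add: power2_eq_square)
    also have "\<dots> \<le> \<alpha> * ip M u u * shifted \<alpha> f f"
      using assms f L2.nonneg[of u] by (intro mult_left_mono) (auto simp: shifted_def)
    finally show "(\<alpha> * ip M u f)\<^sup>2 \<le> \<alpha> * ip M u u * shifted \<alpha> f f" .
  next
    show "0 \<le> \<alpha> * ip M u u" using assms L2.nonneg[of u] by simp
  qed
qed

text \<open>In the usual notation \<open>res \<alpha> = \<alpha> G\<^sub>\<alpha>\<close>, where \<open>G\<^sub>\<alpha>\<close> is the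
  \<open>\<alpha>\<close>-resolvent of the form.\<close>

definition res :: "real \<Rightarrow> 'a rfun \<Rightarrow> 'a rfun" where
  "res \<alpha> u = (SOME r. r \<in> F \<and> (\<forall>v\<in>F. shifted \<alpha> r v = \<alpha> * ip M u v))"

lemma
  assumes "\<alpha> \<ge> 1" "L2fun M u"
  shows res_in [simp, intro]: "res \<alpha> u \<in> F"
    and res_shifted: "v \<in> F \<Longrightarrow> shifted \<alpha> (res \<alpha> u) v = \<alpha> * ip M u v"
proof -
  have "\<exists>r. r \<in> F \<and> (\<forall>v\<in>F. shifted \<alpha> r v = \<alpha> * ip M u v)"
    using resolvent_exists[OF assms] by blast
  then have "res \<alpha> u \<in> F \<and> (\<forall>v\<in>F. shifted \<alpha> (res \<alpha> u) v = \<alpha> * ip M u v)"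
    unfolding res_def by (rule someI_ex)
  then show "res \<alpha> u \<in> F" "v \<in> F \<Longrightarrow> shifted \<alpha> (res \<alpha> u) v = \<alpha> * ip M u v" by auto
qed

lemma E_res:
  assumes "\<alpha> \<ge> 1" "L2fun M u" "v \<in> F"
  shows "E (res \<alpha> u) v = \<alpha> * (ip M u v - ip M (res \<alpha> u) v)"
  using res_shifted[OF assms] unfolding shifted_def by (simp add: algebra_simps)

lemma shifted_self_zero:
  assumes "\<alpha> \<ge> 1" "d \<in> F" "shifted \<alpha> d d = 0"
  shows "AE x in M. d x = 0"
proof -
  have "E d d + \<alpha> * ip M d d = 0" "0 \<le> E d d" "0 \<le> ip M d d"
    using assms L2.nonneg[of d] unfolding shifted_def by auto
  moreover have "ip M d d \<le> \<alpha> * ip M d d"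
    using \<open>0 \<le> ip M d d\<close> assms(1) mult_right_mono[of 1 \<alpha> "ip M d d"] by simp
  ultimately have "ip M d d = 0" by linarith
  then show ?thesis using assms by (intro ip_self_zero) auto
qed

text \<open>\<open>res\<close> picks an arbitrary representative, so identities between its values
  hold almost everywhere; they are obtained by verifying the defining equation.\<close>

lemma res_unique:
  assumes "\<alpha> \<ge> 1" "L2fun M u" "r \<in> F" "\<And>v. v \<in> F \<Longrightarrow> shifted \<alpha> r v = \<alpha> * ip M u v"
  shows "AE x in M. res \<alpha> u x = r x"
proof -
  interpret S: nonneg_form F "shifted \<alpha>" using assms by (intro nonneg_form_shifted) simp
  let ?d = "\<lambda>x. res \<alpha> u x - r x"
  have d: "?d \<in> F" using assms by auto
  have "shifted \<alpha> ?d ?d = shifted \<alpha> (res \<alpha> u) ?d - shifted \<alpha> r ?d"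
    by (rule S.diff_left) (use assms d in auto)
  also have "\<dots> = 0" using assms d res_shifted[OF assms(1,2)] by simp
  finally have "AE x in M. ?d x = 0" by (intro shifted_self_zero[OF assms(1) d])
  then show ?thesis by simp
qed

lemma res_lin:
  assumes "\<alpha> \<ge> 1" "L2fun M u" "L2fun M v"
  shows "AE x in M. res \<alpha> (\<lambda>x. c * u x + v x) x = c * res \<alpha> u x + res \<alpha> v x"
proof (rule res_unique)
  interpret S: nonneg_form F "shifted \<alpha>" using assms by (intro nonneg_form_shifted) simp
  fix w assume "w \<in> F"
  then show "shifted \<alpha> (\<lambda>x. c * res \<alpha> u x + res \<alpha> v x) w = \<alpha> * ip M (\<lambda>x. c * u x + v x) w"
    using assms by (simp add: S.lin_left L2.lin_left res_shifted distrib_left mult.left_commute)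
qed (use assms in auto)

lemma res_zero:
  assumes "\<alpha> \<ge> 1"
  shows "AE x in M. res \<alpha> (\<lambda>x. 0) x = 0"
  using res_lin[of \<alpha> "\<lambda>x. 0" "\<lambda>x. 0" 1] assms by simp

lemma res_scale:
  assumes "\<alpha> \<ge> 1" "L2fun M u"
  shows "AE x in M. res \<alpha> (\<lambda>x. c * u x) x = c * res \<alpha> u x"
  using res_lin[OF assms, of "\<lambda>x. 0" c] res_zero[OF assms(1)] by auto

text \<open>Multiplied by \<alpha>, both sides equal
  \<open>shifted \<alpha> (res \<alpha> u) (res \<alpha> v)\<close>.\<close>

lemma res_sym:
  assumes "\<alpha> \<ge> 1" "L2fun M u" "L2fun M v"
  shows "ip M (res \<alpha> u) v = ip M u (res \<alpha> v)"
proof -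
  interpret S: nonneg_form F "shifted \<alpha>" using assms by (intro nonneg_form_shifted) simp
  have "\<alpha> * ip M u (res \<alpha> v) = shifted \<alpha> (res \<alpha> u) (res \<alpha> v)"
    using assms by (simp add: res_shifted)
  also have "\<dots> = \<alpha> * ip M v (res \<alpha> u)"
    using assms by (subst S.sym) (simp_all add: res_shifted)
  finally show ?thesis using assms(1) by (simp add: ip_commute)
qed

text \<open>\<open>res \<alpha> u\<close> is the unique minimizer of \<open>E v v + \<alpha> * \<parallel>v - u\<parallel>\<^sup>2\<close>, a quantity
  that the unit contraction does not increase when \<open>u\<close> takes values in \<open>[0, 1]\<close>.\<close>

lemma res_unit:
  assumes "\<alpha> \<ge> 1" "L2fun M u" "\<And>x. x \<in> space M \<Longrightarrow> 0 \<le> u x \<and> u x \<le> 1"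
  shows "AE x in M. 0 \<le> res \<alpha> u x \<and> res \<alpha> u x \<le> 1"
proof -
  interpret S: nonneg_form F "shifted \<alpha>" using assms by (intro nonneg_form_shifted) simp
  define r where "r = res \<alpha> u"
  define t where "t = T1 \<circ> r"
  have r: "r \<in> F" unfolding r_def using assms by auto
  have t: "t \<in> F" "E t t \<le> E r r" unfolding t_def using unit_contraction[OF r] by auto
  have "ip M (\<lambda>x. t x - u x) (\<lambda>x. t x - u x) \<le> ip M (\<lambda>x. r x - u x) (\<lambda>x. r x - u x)"
    unfolding ip_def
  proof (rule integral_mono)
    fix x assume "x \<in> space M"
    then have "\<bar>t x - u x\<bar> \<le> \<bar>r x - u x\<bar>"
      using assms(3)[of x] unfolding t_def T1_def by (auto simp: min_def max_def)
    then show "(t x - u x) * (t x - u x) \<le> (r x - u x) * (r x - u x)"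
      using abs_le_square_iff[of "t x - u x" "r x - u x"] by (simp add: power2_eq_square)
  next
    have "L2fun M (\<lambda>x. t x - u x)" "L2fun M (\<lambda>x. r x - u x)"
      using t r assms L2.diff_in by auto
    then show "integrable M (\<lambda>x. (t x - u x) * (t x - u x))"
      "integrable M (\<lambda>x. (r x - u x) * (r x - u x))" by auto
  qed
  then have "ip M t t - 2 * ip M t u \<le> ip M r r - 2 * ip M r u"
    using r t assms by (simp add: L2.diff_self)
  then have "\<alpha> * (ip M t t - 2 * ip M t u) \<le> \<alpha> * (ip M r r - 2 * ip M r u)"
    using assms(1) by simp
  then have "shifted \<alpha> t t - 2 * (\<alpha> * ip M u t) \<le> shifted \<alpha> r r - 2 * (\<alpha> * ip M u r)"
    using t(2) unfolding shifted_def by (simp add: algebra_simps ip_commute)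
  \<comment> \<open>Once \<open>\<alpha> * ip M u v\<close> is replaced by
    \<open>shifted \<alpha> r v\<close> for \<open>v = t\<close> and \<open>v = r\<close>, the
    comparison of the two values of the functional becomes a bound on this square.\<close>
  then have "shifted \<alpha> (\<lambda>x. r x - t x) (\<lambda>x. r x - t x) \<le> 0"
    using r t res_shifted[OF assms(1,2), folded r_def] by (simp add: S.diff_self)
  then have "shifted \<alpha> (\<lambda>x. r x - t x) (\<lambda>x. r x - t x) = 0"
    using S.nonneg[OF E.diff_in[OF r t(1)]] by simp
  then have "AE x in M. r x - t x = 0"
    using r t by (intro shifted_self_zero[OF assms(1)]) auto
  then show ?thesis
    by (rule eventually_mono) (auto simp: t_def r_def[symmetric] T1_def min_def max_def split: if_splits)
qed

text \<open>For \<open>K > 0\<close> this is \<open>res_unit\<close> rescaled. Otherwise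
  \<open>u\<close> vanishes on the space, hence so does \<open>res \<alpha> u\<close> almost
  everywhere; a negative \<open>K\<close> is possible only on an empty space.\<close>

lemma res_between:
  assumes "\<alpha> \<ge> 1" "L2fun M u" "\<And>x. x \<in> space M \<Longrightarrow> 0 \<le> u x \<and> u x \<le> K"
  shows "AE x in M. 0 \<le> res \<alpha> u x \<and> res \<alpha> u x \<le> K"
proof (cases "K > 0")
  case True
  have unscale: "0 \<le> y \<and> y \<le> K" if "0 \<le> inverse K * y" "inverse K * y \<le> 1" for y
    using that True by (simp add: field_simps)
  have "AE x in M. 0 \<le> res \<alpha> (\<lambda>x. inverse K * u x) x \<and> res \<alpha> (\<lambda>x. inverse K * u x) x \<le> 1"
  proof (rule res_unit)
    show "L2fun M (\<lambda>x. inverse K * u x)" using assms by blast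
    show "0 \<le> inverse K * u x \<and> inverse K * u x \<le> 1" if "x \<in> space M" for x
      using assms(3)[OF that] True by (simp add: field_simps)
  qed (rule assms)
  moreover have "AE x in M. res \<alpha> (\<lambda>x. inverse K * u x) x = inverse K * res \<alpha> u x"
    by (rule res_scale) (use assms in auto)
  ultimately show ?thesis
    by eventually_elim (metis unscale)
next
  case False
  then have "u x = 0" if "x \<in> space M" for x using assms(3)[OF that] by linarith
  have "AE x in M. res \<alpha> u x = 0"
  proof (rule res_unique)
    interpret S: nonneg_form F "shifted \<alpha>" using assms by (intro nonneg_form_shifted) simp
    fix v assume "v \<in> F"
    have "ip M u v = 0" unfolding ip_def
      using \<open>\<And>x. x \<in> space M \<Longrightarrow> u x = 0\<close> by (simp cong: Bochner_Integration.integral_cong)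
    then show "shifted \<alpha> (\<lambda>x. 0) v = \<alpha> * ip M u v" using \<open>v \<in> F\<close> by simp
  qed (use assms in auto)
  moreover have "AE x in M. 0 \<le> K" using assms(3) by (intro AE_I2) force
  ultimately show ?thesis by eventually_elim auto
qed

text \<open>With \<open>w = p - q\<close> split into positive and negative part,
  \<open>res \<alpha> p\<close> is at most \<open>k\<close> and \<open>res \<alpha> q\<close> is
  nonnegative. The lower bound on \<open>w\<close> makes \<open>q\<close> bounded, as
  \<open>res_between\<close> requires.\<close>

lemma res_le:
  assumes "\<alpha> \<ge> 1" "L2fun M w" "k \<ge> 0"
    and "\<And>x. x \<in> space M \<Longrightarrow> w x \<le> k" "\<And>x. x \<in> space M \<Longrightarrow> - K \<le> w x"
  shows "AE x in M. res \<alpha> w x \<le> k"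
proof -
  define p q where "p = (\<lambda>x. max (w x) 0)" and "q = (\<lambda>x. max (- w x) 0)"
  have w: "w \<in> borel_measurable M" using assms L2fun_measurable by blast
  have pq: "L2fun M p" "L2fun M q"
    using w by (auto intro!: L2fun_dominated[OF assms(2), where K = 1] simp: p_def q_def)
  have "AE x in M. 0 \<le> res \<alpha> p x \<and> res \<alpha> p x \<le> k"
    by (rule res_between) (use assms pq in \<open>auto simp: p_def\<close>)
  moreover have "AE x in M. 0 \<le> res \<alpha> q x \<and> res \<alpha> q x \<le> max K 0"
    by (rule res_between) (use assms pq in \<open>fastforce simp: q_def\<close>)+
  moreover have "AE x in M. res \<alpha> (\<lambda>x. -1 * q x + p x) x = -1 * res \<alpha> q x + res \<alpha> p x"
    by (rule res_lin) (use assms pq in auto)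
  moreover have "(\<lambda>x. -1 * q x + p x) = w" by (auto simp: p_def q_def max_def)
  ultimately show ?thesis by auto
qed

end

section \<open>Normal contractions, exhaustion of the space, bounded square-integrable
  functions\<close>

lemma normal_contraction_abs_le: "normal_contraction N \<Longrightarrow> \<bar>N a\<bar> \<le> \<bar>a\<bar>"
  unfolding normal_contraction_def by (metis diff_zero)

lemma normal_contraction_diff: "normal_contraction N \<Longrightarrow> \<bar>N a - N b\<bar> \<le> \<bar>a - b\<bar>"
  unfolding normal_contraction_def by blast

lemma normal_contraction_continuous: "normal_contraction N \<Longrightarrow> continuous_on UNIV N"
  by (rule lipschitz_on_continuous_on[of 1])
     (auto intro!: lipschitz_onI simp: dist_real_def normal_contraction_diff)

text \<open>Indicators of an increasing sequence of sets of finite measure replace the constant 1,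
  which need not be square-integrable and so cannot be inserted into the resolvent.\<close>

lemma (in sigma_finite_measure) integral_exhaustion:
  obtains i :: "nat \<Rightarrow> 'a rfun" where "\<And>n. L2fun M (i n)" "\<And>n x. 0 \<le> i n x \<and> i n x \<le> 1"
    "\<And>f :: 'a rfun. integrable M f \<Longrightarrow> (\<lambda>n. \<integral>x. i n x * f x \<partial>M) \<longlonglongrightarrow> (\<integral>x. f x \<partial>M)"
proof -
  obtain A :: "nat \<Rightarrow> 'a set" where A: "range A \<subseteq> sets M" "(\<Union>i. A i) = space M"
      "\<And>i. emeasure M (A i) \<noteq> \<infinity>" "incseq A"
    using sigma_finite_incseq by blast
  have meas: "A n \<in> sets M" for n using A(1) by blast
  define i where "i n = (indicator (A n) :: 'a rfun)" for n
  have [measurable]: "i n \<in> borel_measurable M" for n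
    unfolding i_def using meas by simp
  have sq: "(i n x)\<^sup>2 = i n x" for n x unfolding i_def by (simp add: indicator_def)
  show thesis
  proof (rule that[of i])
    show "L2fun M (i n)" for n
      unfolding L2fun_def sq using meas A(3)[of n]
      by (auto simp: i_def less_top)
    show "0 \<le> i n x \<and> i n x \<le> 1" for n x unfolding i_def by (simp add: indicator_def)
    fix f :: "'a rfun" assume f: "integrable M f"
    show "(\<lambda>n. \<integral>x. i n x * f x \<partial>M) \<longlonglongrightarrow> (\<integral>x. f x \<partial>M)"
    proof (rule integral_dominated_convergence[where w = "\<lambda>x. \<bar>f x\<bar>"])
      show "AE x in M. (\<lambda>n. i n x * f x) \<longlonglongrightarrow> f x"
      proof (rule AE_I2)
        fix x assume "x \<in> space M"
        then obtain n where n: "x \<in> A n" using A(2) by blast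
        have "i m x * f x = f x" if "m \<ge> n" for m
          using n incseqD[OF A(4) that] unfolding i_def by auto
        then show "(\<lambda>n. i n x * f x) \<longlonglongrightarrow> f x"
          by (intro tendsto_eventually) (auto simp: eventually_sequentially)
      qed
      show "AE x in M. norm (i n x * f x) \<le> \<bar>f x\<bar>" for n
        by (rule AE_I2) (simp add: i_def indicator_def)
    qed (use f in \<open>auto intro!: borel_measurable_times\<close>)
  qed
qed

text \<open>No membership in the form domain is included: the density estimates hold on this larger
  class, and membership of \<open>N \<circ> f\<close> in the domain is deduced from them.\<close>

definition bounded_L2 :: "'a measure \<Rightarrow> 'a rfun set" where
  "bounded_L2 M = {f. L2fun M f \<and> bounded (f ` space M)}"

lemma bounded_L2D:
  assumes "f \<in> bounded_L2 M"
  shows "L2fun M f" "f \<in> borel_measurable M" "\<exists>K\<ge>0. \<forall>x\<in>space M. \<bar>f x\<bar> \<le> K"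
proof -
  show "L2fun M f" "f \<in> borel_measurable M"
    using assms unfolding bounded_L2_def by (auto simp: L2fun_measurable)
  obtain K where "\<forall>x\<in>space M. \<bar>f x\<bar> \<le> K"
    using assms unfolding bounded_L2_def bounded_iff by auto
  then show "\<exists>K\<ge>0. \<forall>x\<in>space M. \<bar>f x\<bar> \<le> K"
    by (intro exI[of _ "max K 0"]) (auto simp: le_max_iff_disj)
qed

lemma bounded_L2_dominated:
  assumes "f \<in> bounded_L2 M" "g \<in> borel_measurable M" "\<And>x. x \<in> space M \<Longrightarrow> \<bar>g x\<bar> \<le> C * \<bar>f x\<bar>" "C \<ge> 0"
  shows "g \<in> bounded_L2 M"
proof -
  obtain K where K: "\<forall>x\<in>space M. \<bar>f x\<bar> \<le> K" using bounded_L2D(3)[OF assms(1)] by blast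
  have "\<bar>g x\<bar> \<le> C * K" if "x \<in> space M" for x
    using assms(3)[OF that] mult_left_mono[OF bspec[OF K that] assms(4)] by linarith
  then have "bounded (g ` space M)" unfolding bounded_iff by auto
  then show ?thesis
    using L2fun_dominated[OF bounded_L2D(1)[OF assms(1)] assms(2,3)] unfolding bounded_L2_def by simp
qed

lemma bounded_L2_mult:
  assumes "f \<in> bounded_L2 M" "g \<in> bounded_L2 M"
  shows "(\<lambda>x. f x * g x) \<in> bounded_L2 M"
proof -
  obtain K where K: "K \<ge> 0" "\<forall>x\<in>space M. \<bar>g x\<bar> \<le> K" using bounded_L2D(3)[OF assms(2)] by blast
  show ?thesis
    by (rule bounded_L2_dominated[OF assms(1), where C = K])
       (use K bounded_L2D[OF assms(1)] bounded_L2D[OF assms(2)] in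
        \<open>auto intro!: borel_measurable_times simp: abs_mult mult.commute[of K] mult_left_mono\<close>)
qed

lemma bounded_L2_square: "f \<in> bounded_L2 M \<Longrightarrow> (\<lambda>x. (f x)\<^sup>2) \<in> bounded_L2 M"
  unfolding power2_eq_square by (rule bounded_L2_mult)

lemma bounded_L2_contraction:
  assumes "f \<in> bounded_L2 M" "normal_contraction N"
  shows "N \<circ> f \<in> bounded_L2 M"
proof (rule bounded_L2_dominated[OF assms(1), where C = 1])
  have "N \<in> borel_measurable borel"
    by (intro borel_measurable_continuous_onI normal_contraction_continuous assms)
  then show "N \<circ> f \<in> borel_measurable M"
    using bounded_L2D(2)[OF assms(1)] by (rule measurable_comp[rotated])
qed (use normal_contraction_abs_le[OF assms(2)] in auto)

context dirichlet
begin

section \<open>Approximation of the form by its resolvent\<close>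

text \<open>The Deny-Yosida approximation of \<open>E w w\<close>; it makes sense for every
  square-integrable \<open>w\<close>.\<close>

definition energy :: "real \<Rightarrow> 'a rfun \<Rightarrow> real" where
  "energy \<alpha> w = \<alpha> * (ip M w w - ip M (res \<alpha> w) w)"

text \<open>With r the resolvent of w, the product of w - r with w is its product with r plus the
  square of w - r. Multiplied by \<alpha>, the first part is \<open>E r r\<close>, so the energy is
  a sum of nonnegative terms.\<close>

lemma energy_eq:
  assumes "\<alpha> \<ge> 1" "L2fun M w"
  shows "energy \<alpha> w = E (res \<alpha> w) (res \<alpha> w)
    + \<alpha> * ip M (\<lambda>x. w x - res \<alpha> w x) (\<lambda>x. w x - res \<alpha> w x)"
proof -
  have 1: "E (res \<alpha> w) (res \<alpha> w) = \<alpha> * (ip M w (res \<alpha> w) - ip M (res \<alpha> w) (res \<alpha> w))"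
    using assms by (intro E_res) auto
  have 2: "ip M (\<lambda>x. w x - res \<alpha> w x) (\<lambda>x. w x - res \<alpha> w x)
      = ip M w w - 2 * ip M w (res \<alpha> w) + ip M (res \<alpha> w) (res \<alpha> w)"
    using assms by (intro L2.diff_self) auto
  show ?thesis
    unfolding energy_def 1 2 ip_commute[of M "res \<alpha> w" w] by (simp add: algebra_simps)
qed

lemma energy_bounds:
  assumes "\<alpha> \<ge> 1" "L2fun M w"
  shows "0 \<le> energy \<alpha> w" "E (res \<alpha> w) (res \<alpha> w) \<le> energy \<alpha> w"
    "\<alpha> * ip M (\<lambda>x. w x - res \<alpha> w x) (\<lambda>x. w x - res \<alpha> w x) \<le> energy \<alpha> w"
proof -
  have "L2fun M (\<lambda>x. w x - res \<alpha> w x)" using assms L2.diff_in by auto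
  then have "0 \<le> \<alpha> * ip M (\<lambda>x. w x - res \<alpha> w x) (\<lambda>x. w x - res \<alpha> w x)"
    using assms(1) by (intro mult_nonneg_nonneg L2.nonneg) auto
  moreover have "0 \<le> E (res \<alpha> w) (res \<alpha> w)" using assms by simp
  ultimately show "0 \<le> energy \<alpha> w" "E (res \<alpha> w) (res \<alpha> w) \<le> energy \<alpha> w"
    "\<alpha> * ip M (\<lambda>x. w x - res \<alpha> w x) (\<lambda>x. w x - res \<alpha> w x) \<le> energy \<alpha> w"
    using energy_eq[OF assms] by linarith+
qed

text \<open>The energy is \<open>E (res \<alpha> w) w\<close>; twice it is at most
  \<open>E (res \<alpha> w) (res \<alpha> w) + E w w\<close>, whose first term is again at most the
  energy.\<close>

lemma energy_le:
  assumes "\<alpha> \<ge> 1" "w \<in> F"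
  shows "energy \<alpha> w \<le> E w w"
proof -
  have "energy \<alpha> w = E (res \<alpha> w) w"
    using assms by (simp add: E_res energy_def)
  then show ?thesis
    using E.arith_geo_mean[of "res \<alpha> w" w] energy_bounds(2)[of \<alpha> w] assms by auto
qed

text \<open>Quantitative monotonicity of the energy in its parameter: increments control distances
  of resolvents, so a bounded energy forces them to be Cauchy.\<close>

lemma shifted_res_diff_le:
  assumes "1 \<le> \<beta>" "\<beta> \<le> \<gamma>" "L2fun M w"
  shows "shifted 1 (\<lambda>x. res \<gamma> w x - res \<beta> w x) (\<lambda>x. res \<gamma> w x - res \<beta> w x)
    \<le> energy \<gamma> w - energy \<beta> w"
proof -
  let ?r = "res \<gamma> w" and ?s = "res \<beta> w"
  let ?d = "\<lambda>x. ?r x - ?s x"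
  have F: "?r \<in> F" "?s \<in> F" "?d \<in> F" using assms by auto
  have wr: "L2fun M (\<lambda>x. w x - ?r x)" using F assms L2.diff_in by auto
  have "shifted 1 ?d ?d \<le> E ?d ?d + \<beta> * ip M ?d ?d"
    using mult_right_mono[OF assms(1) L2.nonneg[of ?d]] F unfolding shifted_def by simp
  also have "\<dots> = (E ?r ?r - 2 * E ?s ?r + E ?s ?s) + \<beta> * (ip M ?r ?r - 2 * ip M ?s ?r + ip M ?s ?s)"
    using F by (simp add: E.diff_self L2.diff_self E.sym[of ?r ?s] ip_commute[of M ?r ?s])
  \<comment> \<open>The mixed term is evaluated by the equation of the smaller parameter \<beta>,
    which makes the products of \<open>?s\<close> with \<open>?r\<close> and with itself
    cancel.\<close>
  also have "\<dots> = energy \<gamma> w - energy \<beta> w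
      - (\<gamma> - \<beta>) * (ip M w w - 2 * ip M w ?r + ip M ?r ?r)"
    using assms F unfolding energy_def
    by (simp add: E_res ip_commute[of M w ?s] ip_commute[of M w ?r] algebra_simps)
  finally have "shifted 1 ?d ?d \<le> energy \<gamma> w - energy \<beta> w
      - (\<gamma> - \<beta>) * (ip M w w - 2 * ip M w ?r + ip M ?r ?r)" .
  moreover have "ip M w w - 2 * ip M w ?r + ip M ?r ?r = ip M (\<lambda>x. w x - ?r x) (\<lambda>x. w x - ?r x)"
    using F assms by (simp add: L2.diff_self)
  moreover have "0 \<le> (\<gamma> - \<beta>) * ip M (\<lambda>x. w x - ?r x) (\<lambda>x. w x - ?r x)"
    using wr assms(2) by (intro mult_nonneg_nonneg L2.nonneg) auto
  ultimately show ?thesis by simp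
qed

text \<open>Converse to \<open>energy_le\<close> and the membership criterion for the domain. The
  resolvents converge in \<open>shifted 1\<close> to some \<open>f\<close> in the domain, while the
  energy bound makes the square of \<open>w - res \<alpha> w\<close> at most
  \<open>C / \<alpha>\<close>. Hence \<open>f = w\<close> almost everywhere, and saturation puts
  \<open>w\<close> itself into the domain.\<close>

lemma energy_bounded_imp_in:
  assumes w: "L2fun M w" and C: "\<And>\<alpha>. \<alpha> \<ge> 1 \<Longrightarrow> energy \<alpha> w \<le> C"
  shows "w \<in> F"
    and "(\<lambda>n. E (\<lambda>x. res (real (Suc n)) w x - w x) (\<lambda>x. res (real (Suc n)) w x - w x)) \<longlonglongrightarrow> 0"
    and "E w w \<le> C"
proof -
  interpret S: nonneg_form F "shifted 1" by (intro nonneg_form_shifted) simp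
  \<comment> \<open>\<open>Suc n\<close> keeps the parameter at least 1, as the statements about
    \<open>res\<close> require.\<close>
  define r where "r n = res (real (Suc n)) w" for n
  define e where "e n = energy (real (Suc n)) w" for n
  have r: "r n \<in> F" for n unfolding r_def using w by auto
  have diff: "shifted 1 (\<lambda>x. r n x - r m x) (\<lambda>x. r n x - r m x) \<le> \<bar>e n - e m\<bar>" for n m
  proof (cases "m \<le> n")
    case True
    then show ?thesis
      using shifted_res_diff_le[of "real (Suc m)" "real (Suc n)" w] w unfolding r_def e_def by simp
  next
    case False
    then have "shifted 1 (\<lambda>x. r m x - r n x) (\<lambda>x. r m x - r n x) \<le> e m - e n"
      using shifted_res_diff_le[of "real (Suc n)" "real (Suc m)" w] w unfolding r_def e_def by simp
    moreover have "shifted 1 (\<lambda>x. r m x - r n x) (\<lambda>x. r m x - r n x)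
        = shifted 1 (\<lambda>x. r n x - r m x) (\<lambda>x. r n x - r m x)"
      using r by (simp add: S.diff_self S.sym[of "r m" "r n"])
    ultimately show ?thesis by linarith
  qed
  have "incseq e"
  proof (rule monoI)
    fix m n :: nat assume "m \<le> n"
    then have "shifted 1 (\<lambda>x. r n x - r m x) (\<lambda>x. r n x - r m x) \<le> e n - e m"
      unfolding r_def e_def using w by (intro shifted_res_diff_le) auto
    moreover have "0 \<le> shifted 1 (\<lambda>x. r n x - r m x) (\<lambda>x. r n x - r m x)"
      using r by (intro S.nonneg) auto
    ultimately show "e m \<le> e n" by linarith
  qed
  moreover have e_le: "e n \<le> C" for n unfolding e_def by (rule C) simp
  ultimately have "convergent e" using incseq_convergent[of e C] by (metis convergentI)
  then have "Cauchy e" by (rule convergent_Cauchy)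
  have "form_cauchy (shifted 1) r"
    unfolding form_cauchy_def
  proof (intro allI impI)
    fix \<epsilon> :: real assume "\<epsilon> > 0"
    then obtain N where N: "\<And>m n. m \<ge> N \<Longrightarrow> n \<ge> N \<Longrightarrow> \<bar>e m - e n\<bar> < \<epsilon>"
      using CauchyD[OF \<open>Cauchy e\<close>] by fastforce
    have "shifted 1 (\<lambda>x. r n x - r m x) (\<lambda>x. r n x - r m x) < \<epsilon>" if "m \<ge> N" "n \<ge> N" for m n
      using diff[of n m] N[OF that(2,1)] by linarith
    then show "\<exists>N. \<forall>m\<ge>N. \<forall>n\<ge>N. shifted 1 (\<lambda>x. r n x - r m x) (\<lambda>x. r n x - r m x) < \<epsilon>"
      by blast
  qed
  then obtain f where f: "f \<in> F" "(\<lambda>n. shifted 1 (\<lambda>x. r n x - f x) (\<lambda>x. r n x - f x)) \<longlonglongrightarrow> 0"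
    using complete r by blast
  have rf: "(\<lambda>x. r n x - f x) \<in> F" for n using r f(1) by auto
  have rf2: "0 \<le> ip M (\<lambda>x. r n x - f x) (\<lambda>x. r n x - f x)" for n using rf[of n] L2.nonneg by blast
  have "0 \<le> E (\<lambda>x. r n x - f x) (\<lambda>x. r n x - f x)"
    "E (\<lambda>x. r n x - f x) (\<lambda>x. r n x - f x) \<le> shifted 1 (\<lambda>x. r n x - f x) (\<lambda>x. r n x - f x)"
    "ip M (\<lambda>x. r n x - f x) (\<lambda>x. r n x - f x) \<le> shifted 1 (\<lambda>x. r n x - f x) (\<lambda>x. r n x - f x)" for n
    using E.nonneg[OF rf, of n] rf2[of n] unfolding shifted_def by auto
  note bnds = this
  have limE: "(\<lambda>n. E (\<lambda>x. r n x - f x) (\<lambda>x. r n x - f x)) \<longlonglongrightarrow> 0"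
    by (rule tendsto_sandwich[OF always_eventually always_eventually tendsto_const f(2)])
       (use bnds in blast)+
  have limI: "(\<lambda>n. ip M (\<lambda>x. r n x - f x) (\<lambda>x. r n x - f x)) \<longlonglongrightarrow> 0"
    by (rule tendsto_sandwich[OF always_eventually always_eventually tendsto_const f(2)])
       (use bnds rf2 in blast)+
  have wr: "L2fun M (\<lambda>x. w x - r n x)" for n using w r[of n] L2.diff_in by auto
  have wr_le: "ip M (\<lambda>x. w x - r n x) (\<lambda>x. w x - r n x) \<le> C * inverse (real (Suc n))" for n
    using energy_bounds(3)[of "real (Suc n)" w] w e_le[of n] unfolding r_def e_def
    by (simp add: field_simps)
  have wr_nonneg: "0 \<le> ip M (\<lambda>x. w x - r n x) (\<lambda>x. w x - r n x)" for n
    using wr[of n] by (intro L2.nonneg) simp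
  have lim_inv: "(\<lambda>n. C * inverse (real (Suc n))) \<longlonglongrightarrow> 0"
    using tendsto_mult[OF tendsto_const[of C] LIMSEQ_inverse_real_of_nat] by simp
  have limW: "(\<lambda>n. ip M (\<lambda>x. w x - r n x) (\<lambda>x. w x - r n x)) \<longlonglongrightarrow> 0"
    by (rule tendsto_sandwich[OF always_eventually always_eventually tendsto_const lim_inv])
       (use wr_le wr_nonneg in blast)+
  have wf: "L2fun M (\<lambda>x. w x - f x)" using w f(1) L2.diff_in by auto
  have "ip M (\<lambda>x. w x - f x) (\<lambda>x. w x - f x) \<le> 2 * ip M (\<lambda>x. w x - r n x) (\<lambda>x. w x - r n x)
      + 2 * ip M (\<lambda>x. r n x - f x) (\<lambda>x. r n x - f x)" for n
    using L2.add_self_le[of "\<lambda>x. w x - r n x" "\<lambda>x. r n x - f x"] wr[of n] rf[of n] by auto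
  then have "ip M (\<lambda>x. w x - f x) (\<lambda>x. w x - f x) \<le> 2 * 0 + 2 * 0"
    by (intro LIMSEQ_le_const[OF tendsto_add[OF tendsto_mult[OF tendsto_const limW] tendsto_mult[OF tendsto_const limI]]])
       auto
  moreover have "0 \<le> ip M (\<lambda>x. w x - f x) (\<lambda>x. w x - f x)"
    using wf by (intro L2.nonneg) simp
  ultimately have "ip M (\<lambda>x. w x - f x) (\<lambda>x. w x - f x) = 0" by simp
  then have wf_AE: "AE x in M. w x - f x = 0" using wf by (rule ip_self_zero[rotated])
  then have "AE x in M. f x = w x" by (rule eventually_mono) simp
  then show wF: "w \<in> F" by (rule AE_in[OF f(1) L2fun_measurable[OF w]])
  have "E (\<lambda>x. r n x - f x) (\<lambda>x. r n x - f x) = E (\<lambda>x. r n x - w x) (\<lambda>x. r n x - w x)" for n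
  proof (rule E_AE_cong)
    show "AE x in M. r n x - f x = r n x - w x" using wf_AE by (rule eventually_mono) simp
  qed (use r f(1) wF in auto)
  then show lim: "(\<lambda>n. E (\<lambda>x. res (real (Suc n)) w x - w x) (\<lambda>x. res (real (Suc n)) w x - w x)) \<longlonglongrightarrow> 0"
    using limE unfolding r_def by simp
  have "(\<lambda>n. E (r n) w) \<longlonglongrightarrow> E w w"
    using lim wF r unfolding r_def by (intro E.tendsto_form_left) auto
  moreover have "E (r n) w = e n" for n
    unfolding r_def e_def energy_def using w wF by (simp add: E_res)
  ultimately show "E w w \<le> C" using e_le LIMSEQ_le_const2[of "\<lambda>n. E (r n) w"] by auto
qed

lemma
  assumes "w \<in> F"
  shows res_tendsto: "(\<lambda>n. E (\<lambda>x. res (real (Suc n)) w x - w x) (\<lambda>x. res (real (Suc n)) w x - w x)) \<longlonglongrightarrow> 0"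
    and E_res_tendsto: "v \<in> F \<Longrightarrow> (\<lambda>n. E (res (real (Suc n)) w) v) \<longlonglongrightarrow> E w v"
proof -
  show lim: "(\<lambda>n. E (\<lambda>x. res (real (Suc n)) w x - w x) (\<lambda>x. res (real (Suc n)) w x - w x)) \<longlonglongrightarrow> 0"
    using assms energy_le by (intro energy_bounded_imp_in(2)[of w "E w w"]) auto
  show "(\<lambda>n. E (res (real (Suc n)) w) v) \<longlonglongrightarrow> E w v" if "v \<in> F"
    using assms lim that by (intro E.tendsto_form_left) auto
qed

text \<open>The resolvents of \<open>w\<close> approximate it in \<open>E\<close>, and pairing in
  \<open>E\<close> with a resolvent is a multiple of an L2 pairing, which vanishes in the
  limit.\<close>

lemma E_weak_tendsto:
  assumes v: "\<And>n. v n \<in> F" and lim: "(\<lambda>n. ip M (v n) (v n)) \<longlonglongrightarrow> 0"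
    and C: "\<forall>\<^sub>F n in sequentially. E (v n) (v n) \<le> C" and w: "w \<in> F"
  shows "(\<lambda>n. E (v n) w) \<longlonglongrightarrow> 0"
proof (rule E.tendsto_zero_of_approximations[OF v C w])
  fix e :: real assume "e > 0"
  then obtain k where "norm (E (\<lambda>x. res (real (Suc k)) w x - w x) (\<lambda>x. res (real (Suc k)) w x - w x) - 0) < e"
    using LIMSEQ_D[OF res_tendsto[OF w]] by blast
  then have k: "E (\<lambda>x. res (real (Suc k)) w x - w x) (\<lambda>x. res (real (Suc k)) w x - w x) < e"
    by (simp add: abs_less_iff)
  define r where "r = res (real (Suc k)) w"
  have r: "r \<in> F" unfolding r_def using w by auto
  have "(\<lambda>n. ip M (v n) (\<lambda>x. w x - r x)) \<longlonglongrightarrow> ip M (\<lambda>x. 0) (\<lambda>x. w x - r x)"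
    using lim v r w L2.diff_in by (intro L2.tendsto_form_left) auto
  then have "(\<lambda>n. real (Suc k) * ip M (v n) (\<lambda>x. w x - r x)) \<longlonglongrightarrow> real (Suc k) * 0"
    by (intro tendsto_intros) (simp add: ip_def)
  moreover have "real (Suc k) * ip M (v n) (\<lambda>x. w x - r x) = E (v n) r" for n
    using E_res[of "real (Suc k)" w "v n"] v[of n] w r E.sym[of "v n" r]
    unfolding r_def by (simp add: L2.expand ip_commute[of M "v n" w] ip_commute[of M "v n" "res (1 + real k) w"])
  ultimately have "(\<lambda>n. E (v n) r) \<longlonglongrightarrow> 0" by (simp only: mult_zero_right)
  then show "\<exists>r\<in>F. E (\<lambda>x. r x - w x) (\<lambda>x. r x - w x) < e \<and> (\<lambda>n. E (v n) r) \<longlonglongrightarrow> 0"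
    using r k unfolding r_def by blast
qed

end

context dirichlet
begin

section \<open>Contraction of the approximating energy densities\<close>

text \<open>For a kernel operator \<open>res \<alpha>\<close> without killing this is
  \<open>\<integral> (f x - f y)\<^sup>2 res \<alpha> (x, dy)\<close>.\<close>

definition energy_density :: "real \<Rightarrow> 'a rfun \<Rightarrow> 'a rfun" where
  "energy_density \<alpha> f = (\<lambda>x. (f x)\<^sup>2 - 2 * (f x * res \<alpha> f x) + res \<alpha> (\<lambda>x. (f x)\<^sup>2) x)"

text \<open>The last formula moves \<open>res \<alpha>\<close> from \<open>f\<^sup>2\<close> to the
  test function, where the bound by 1 applies if the test function takes values in [0, 1].\<close>

lemma
  assumes "\<alpha> \<ge> 1" "f \<in> bounded_L2 M"
  shows L2fun_mult_res: "L2fun M (\<lambda>x. f x * res \<alpha> f x)"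
    and L2fun_energy_density: "L2fun M (energy_density \<alpha> f)"
    and ip_energy_density: "L2fun M i \<Longrightarrow> ip M i (energy_density \<alpha> f) =
      ip M i (\<lambda>x. (f x)\<^sup>2) - 2 * ip M i (\<lambda>x. f x * res \<alpha> f x) + ip M (res \<alpha> i) (\<lambda>x. (f x)\<^sup>2)"
proof -
  have sq: "L2fun M (\<lambda>x. (f x)\<^sup>2)" using bounded_L2D(1)[OF bounded_L2_square[OF assms(2)]] .
  obtain K where K: "\<forall>x\<in>space M. \<bar>f x\<bar> \<le> K" using bounded_L2D(3)[OF assms(2)] by blast
  have "res \<alpha> f \<in> F" using assms bounded_L2D(1) by auto
  then show fr: "L2fun M (\<lambda>x. f x * res \<alpha> f x)"
    using K bounded_L2D(2)[OF assms(2)] by (intro L2fun_mult_bounded(1)) auto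
  have rsq: "L2fun M (res \<alpha> (\<lambda>x. (f x)\<^sup>2))" using assms sq by auto
  have sum: "L2fun M (\<lambda>x. (f x)\<^sup>2 - 2 * (f x * res \<alpha> f x))"
    using L2.diff_in[OF _ L2.scale_in[of _ 2]] sq fr by simp
  then show "L2fun M (energy_density \<alpha> f)" unfolding energy_density_def using rsq by auto
  assume i: "L2fun M i"
  have "ip M i (energy_density \<alpha> f)
      = ip M i (\<lambda>x. (f x)\<^sup>2 - 2 * (f x * res \<alpha> f x)) + ip M i (res \<alpha> (\<lambda>x. (f x)\<^sup>2))"
    unfolding energy_density_def by (rule L2.add_right) (use i sum rsq in auto)
  also have "ip M i (\<lambda>x. (f x)\<^sup>2 - 2 * (f x * res \<alpha> f x))
      = ip M i (\<lambda>x. (f x)\<^sup>2) - ip M i (\<lambda>x. 2 * (f x * res \<alpha> f x))"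
    by (rule L2.diff_right) (use i sq fr in auto)
  also have "ip M i (\<lambda>x. 2 * (f x * res \<alpha> f x)) = 2 * ip M i (\<lambda>x. f x * res \<alpha> f x)"
    by (rule L2.scale_right) (use i fr in auto)
  also have "ip M i (res \<alpha> (\<lambda>x. (f x)\<^sup>2)) = ip M (res \<alpha> i) (\<lambda>x. (f x)\<^sup>2)"
    using assms(1) i sq by (intro res_sym[symmetric])
  finally show "ip M i (energy_density \<alpha> f) =
      ip M i (\<lambda>x. (f x)\<^sup>2) - 2 * ip M i (\<lambda>x. f x * res \<alpha> f x) + ip M (res \<alpha> i) (\<lambda>x. (f x)\<^sup>2)" .
qed

text \<open>With \<open>g = N \<circ> f\<close> and \<open>b = N a\<close>, the function
  \<open>w = 2 a f - 2 b g + g\<^sup>2 - f\<^sup>2 = (g - b)\<^sup>2 - (f - a)\<^sup>2 + a\<^sup>2 - b\<^sup>2\<close> is at most the constant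
  \<open>a\<^sup>2 - b\<^sup>2 \<ge> 0\<close>, hence so is \<open>res \<alpha> w\<close>.  For \<open>a = f x\<close> this is the claim at \<open>x\<close>; the
  null sets are controlled by taking \<open>a\<close> rational first.\<close>

lemma energy_density_contraction:
  assumes \<alpha>: "\<alpha> \<ge> 1" and f: "f \<in> bounded_L2 M" and N: "normal_contraction N"
  shows "AE x in M. energy_density \<alpha> (N \<circ> f) x \<le> energy_density \<alpha> f x"
proof -
  define g where "g = N \<circ> f"
  have g: "g \<in> bounded_L2 M" unfolding g_def by (rule bounded_L2_contraction[OF f N])
  define f2 g2 where "f2 = (\<lambda>x. (f x)\<^sup>2)" and "g2 = (\<lambda>x. (g x)\<^sup>2)"
  have L2: "L2fun M f" "L2fun M g" "L2fun M f2" "L2fun M g2"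
    unfolding f2_def g2_def using bounded_L2D(1)[OF f] bounded_L2D(1)[OF g]
      bounded_L2D(1)[OF bounded_L2_square[OF f]] bounded_L2D(1)[OF bounded_L2_square[OF g]] by auto
  obtain K where K: "K \<ge> 0" "\<forall>x\<in>space M. \<bar>f x\<bar> \<le> K" using bounded_L2D(3)[OF f] by blast
  have res_w: "AE x in M. 2 * a * res \<alpha> f x - 2 * N a * res \<alpha> g x + res \<alpha> g2 x - res \<alpha> f2 x
      \<le> a\<^sup>2 - (N a)\<^sup>2" for a
  proof -
    \<comment> \<open>The combination is built in three stages, each of the shape treated by
      \<open>res_lin\<close>.\<close>
    define w1 where "w1 = (\<lambda>x. -1 * f2 x + g2 x)"
    define w2 where "w2 = (\<lambda>x. (- 2 * N a) * g x + w1 x)"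
    define w where "w = (\<lambda>x. (2 * a) * f x + w2 x)"
    have w1: "L2fun M w1" unfolding w1_def by (intro L2fun_add L2fun_scale L2)
    have w2: "L2fun M w2" unfolding w2_def by (intro L2fun_add L2fun_scale L2 w1)
    have w: "L2fun M w" unfolding w_def by (intro L2fun_add L2fun_scale L2 w2)
    have w_eq: "w x = (g x - N a)\<^sup>2 - (f x - a)\<^sup>2 + (a\<^sup>2 - (N a)\<^sup>2)" for x
      unfolding w_def w2_def w1_def f2_def g2_def by (simp add: power2_eq_square algebra_simps)
    have "AE x in M. res \<alpha> w x \<le> a\<^sup>2 - (N a)\<^sup>2"
    proof (rule res_le[OF \<alpha> w])
      have "\<bar>N a\<bar>\<^sup>2 \<le> \<bar>a\<bar>\<^sup>2" by (intro power_mono normal_contraction_abs_le N) auto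
      then show a: "0 \<le> a\<^sup>2 - (N a)\<^sup>2" by simp
      fix x assume x: "x \<in> space M"
      have "\<bar>g x - N a\<bar>\<^sup>2 \<le> \<bar>f x - a\<bar>\<^sup>2"
        unfolding g_def comp_def by (intro power_mono normal_contraction_diff N) auto
      then show "w x \<le> a\<^sup>2 - (N a)\<^sup>2" unfolding w_eq by simp
      have "\<bar>f x - a\<bar>\<^sup>2 \<le> (K + \<bar>a\<bar>)\<^sup>2"
        using bspec[OF K(2) x] by (intro power_mono) auto
      moreover have "0 \<le> (g x - N a)\<^sup>2" by simp
      ultimately show "- ((K + \<bar>a\<bar>)\<^sup>2) \<le> w x" unfolding w_eq power2_abs using a by linarith
    qed
    moreover have "AE x in M. res \<alpha> w1 x = -1 * res \<alpha> f2 x + res \<alpha> g2 x"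
      unfolding w1_def by (rule res_lin[OF \<alpha> L2(3,4)])
    moreover have "AE x in M. res \<alpha> w2 x = (- 2 * N a) * res \<alpha> g x + res \<alpha> w1 x"
      unfolding w2_def by (rule res_lin[OF \<alpha> L2(2) w1])
    moreover have "AE x in M. res \<alpha> w x = (2 * a) * res \<alpha> f x + res \<alpha> w2 x"
      unfolding w_def by (rule res_lin[OF \<alpha> L2(1) w2])
    ultimately show ?thesis by eventually_elim simp
  qed
  then have "AE x in M. \<forall>a\<in>\<rat>. 2 * a * res \<alpha> f x - 2 * N a * res \<alpha> g x + res \<alpha> g2 x - res \<alpha> f2 x
      \<le> a\<^sup>2 - (N a)\<^sup>2"
    by (intro AE_ball_countable' countable_rat) auto
  then show ?thesis
  proof eventually_elim
    case (elim x)
    \<comment> \<open>For fixed \<open>x\<close> both sides are continuous in \<open>a\<close>, so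
      the inequality extends from rational \<open>a\<close> to \<open>a = f x\<close>.\<close>
    let ?S = "{a. 2 * a * res \<alpha> f x - 2 * N a * res \<alpha> g x + res \<alpha> g2 x - res \<alpha> f2 x \<le> a\<^sup>2 - (N a)\<^sup>2}"
    have "closed ?S"
      by (intro closed_Collect_le continuous_intros normal_contraction_continuous[OF N])
    moreover have "\<rat> \<subseteq> ?S" using elim by blast
    ultimately have "closure \<rat> \<subseteq> ?S" by (rule closure_minimal[rotated])
    then have "f x \<in> ?S" unfolding Rats_closure_real by blast
    then show ?case
      unfolding energy_density_def by (simp add: g_def f2_def g2_def algebra_simps)
  qed
qed

text \<open>For \<open>h = 1\<close> the integral of the density is twice the energy minus the killing part
  \<open>\<integral> f\<^sup>2 (1 - res \<alpha> 1)\<close>, which \<open>N\<close> does not increase either.\<close>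

lemma energy_density_diff_le:
  assumes \<alpha>: "\<alpha> \<ge> 1" and f: "f \<in> bounded_L2 M" and N: "normal_contraction N"
    and h: "h \<in> bounded_L2 M" "\<And>x. x \<in> space M \<Longrightarrow> \<bar>h x\<bar> \<le> K" and "K \<ge> 0"
  shows "\<alpha> * (ip M h (energy_density \<alpha> f) - ip M h (energy_density \<alpha> (N \<circ> f)))
    \<le> 2 * K * (energy \<alpha> f - energy \<alpha> (N \<circ> f))"
proof -
  define g where "g = N \<circ> f"
  have g: "g \<in> bounded_L2 M" unfolding g_def by (rule bounded_L2_contraction[OF f N])
  have fL: "L2fun M f" and gL: "L2fun M g" using bounded_L2D(1) f g by auto
  have sq: "L2fun M (\<lambda>x. (f x)\<^sup>2)" "L2fun M (\<lambda>x. (g x)\<^sup>2)"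
    using bounded_L2D(1)[OF bounded_L2_square[OF f]] bounded_L2D(1)[OF bounded_L2_square[OF g]] by auto
  obtain i :: "nat \<Rightarrow> 'a rfun" where i: "\<And>n. L2fun M (i n)" "\<And>n x. 0 \<le> i n x \<and> i n x \<le> 1"
    "\<And>u :: 'a rfun. integrable M u \<Longrightarrow> (\<lambda>n. \<integral>x. i n x * u x \<partial>M) \<longlonglongrightarrow> (\<integral>x. u x \<partial>M)"
    using integral_exhaustion by blast
  define \<delta> where "\<delta> = (\<lambda>x. energy_density \<alpha> f x - energy_density \<alpha> g x)"
  have \<delta>: "L2fun M \<delta>" unfolding \<delta>_def
    using L2.diff_in[of "energy_density \<alpha> f" "energy_density \<alpha> g"]
      L2fun_energy_density[OF \<alpha> f] L2fun_energy_density[OF \<alpha> g] by simp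
  have \<delta>_nonneg: "AE x in M. 0 \<le> \<delta> x"
    using energy_density_contraction[OF \<alpha> f N] unfolding \<delta>_def g_def by simp
  have intff: "integrable M (\<lambda>x. (f x)\<^sup>2)" "integrable M (\<lambda>x. (g x)\<^sup>2)"
    using fL gL unfolding L2fun_def by auto
  have fr: "integrable M (\<lambda>x. f x * res \<alpha> f x)" "integrable M (\<lambda>x. g x * res \<alpha> g x)"
    using fL gL \<alpha> by auto
  \<comment> \<open>The cut-off \<open>i n\<close> stands in for the constant 1. Since
    \<open>res \<alpha> (i n)\<close> is at most 1 and
    \<open>(g x)\<^sup>2 \<le> (f x)\<^sup>2\<close>, the term with
    \<open>res \<alpha> (i n)\<close> is replaced by the full integrals before \<open>n\<close>
    tends to infinity.\<close>
  have step: "ip M (i n) (\<lambda>x. h x * \<delta> x) \<le> K * (ip M (i n) (\<lambda>x. (f x)\<^sup>2) - ip M (i n) (\<lambda>x. (g x)\<^sup>2)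
      - 2 * (ip M (i n) (\<lambda>x. f x * res \<alpha> f x) - ip M (i n) (\<lambda>x. g x * res \<alpha> g x))
      + (ip M f f - ip M g g))" (is "_ \<le> K * ?R") for n
  proof -
    have hi: "L2fun M (\<lambda>x. h x * i n x)"
      using h bounded_L2D(2)[OF h(1)] i(1) by (intro L2fun_mult_bounded(1)) auto
    have Ki: "L2fun M (\<lambda>x. K * i n x)" using i(1) by blast
    have "ip M (i n) (\<lambda>x. h x * \<delta> x) = (\<integral>x. (h x * i n x) * \<delta> x \<partial>M)"
      unfolding ip_def by (simp add: mult_ac)
    also have "\<dots> \<le> (\<integral>x. (K * i n x) * \<delta> x \<partial>M)"
    proof (rule integral_mono_AE)
      show "AE x in M. (h x * i n x) * \<delta> x \<le> (K * i n x) * \<delta> x"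
        using \<delta>_nonneg AE_space
      proof eventually_elim
        case (elim x)
        have "h x \<le> K" using h(2)[OF elim(2)] by linarith
        then show ?case using elim(1) i(2) by (intro mult_right_mono) auto
      qed
    qed (use hi Ki \<delta> in auto)
    also have "\<dots> = K * ip M (i n) \<delta>" unfolding ip_def by (simp add: mult.assoc)
    also have "\<dots> \<le> K * ?R"
    proof (rule mult_left_mono[OF _ \<open>K \<ge> 0\<close>])
      have r1: "AE x in M. 0 \<le> res \<alpha> (i n) x \<and> res \<alpha> (i n) x \<le> 1"
        using i by (intro res_unit[OF \<alpha>])
      have ri: "L2fun M (res \<alpha> (i n))" using \<alpha> i(1) by auto
      have "ip M (res \<alpha> (i n)) (\<lambda>x. (f x)\<^sup>2) - ip M (res \<alpha> (i n)) (\<lambda>x. (g x)\<^sup>2)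
          = (\<integral>x. res \<alpha> (i n) x * ((f x)\<^sup>2 - (g x)\<^sup>2) \<partial>M)"
        unfolding ip_def using ri sq by (simp add: right_diff_distrib)
      also have "\<dots> \<le> (\<integral>x. (f x)\<^sup>2 - (g x)\<^sup>2 \<partial>M)"
      proof (rule integral_mono_AE)
        show "AE x in M. res \<alpha> (i n) x * ((f x)\<^sup>2 - (g x)\<^sup>2) \<le> (f x)\<^sup>2 - (g x)\<^sup>2"
          using r1
        proof eventually_elim
          case (elim x)
          have "\<bar>g x\<bar>\<^sup>2 \<le> \<bar>f x\<bar>\<^sup>2"
            unfolding g_def comp_def by (intro power_mono normal_contraction_abs_le N) auto
          then show ?case using elim mult_right_mono[of "res \<alpha> (i n) x" 1 "(f x)\<^sup>2 - (g x)\<^sup>2"] by simp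
        qed
        show "integrable M (\<lambda>x. res \<alpha> (i n) x * ((f x)\<^sup>2 - (g x)\<^sup>2))"
          using ri sq L2.diff_in[of "\<lambda>x. (f x)\<^sup>2" "\<lambda>x. (g x)\<^sup>2"] by (intro L2fun_integrable_mult) auto
      qed (use intff in auto)
      also have "\<dots> = ip M f f - ip M g g"
        unfolding ip_def using intff by (simp add: power2_eq_square)
      finally have "ip M (res \<alpha> (i n)) (\<lambda>x. (f x)\<^sup>2) - ip M (res \<alpha> (i n)) (\<lambda>x. (g x)\<^sup>2)
          \<le> ip M f f - ip M g g" .
      moreover have "ip M (i n) \<delta> = ip M (i n) (energy_density \<alpha> f) - ip M (i n) (energy_density \<alpha> g)"
        unfolding \<delta>_def using i(1) L2fun_energy_density[OF \<alpha> f] L2fun_energy_density[OF \<alpha> g]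
        by (intro L2.diff_right) auto
      ultimately show "ip M (i n) \<delta> \<le> ?R"
        using ip_energy_density[OF \<alpha> f i(1)[of n]] ip_energy_density[OF \<alpha> g i(1)[of n]] by argo
    qed
    finally show ?thesis .
  qed
  have lim: "(\<lambda>n. ip M (i n) u) \<longlonglongrightarrow> (\<integral>x. u x \<partial>M)" if "integrable M u" for u :: "'a rfun"
    using i(3)[OF that] unfolding ip_def .
  have limR: "(\<lambda>n. K * (ip M (i n) (\<lambda>x. (f x)\<^sup>2) - ip M (i n) (\<lambda>x. (g x)\<^sup>2)
      - 2 * (ip M (i n) (\<lambda>x. f x * res \<alpha> f x) - ip M (i n) (\<lambda>x. g x * res \<alpha> g x))
      + (ip M f f - ip M g g))) \<longlonglongrightarrow> K * ((\<integral>x. (f x)\<^sup>2 \<partial>M) - (\<integral>x. (g x)\<^sup>2 \<partial>M)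
      - 2 * ((\<integral>x. f x * res \<alpha> f x \<partial>M) - (\<integral>x. g x * res \<alpha> g x \<partial>M)) + (ip M f f - ip M g g))"
    by (intro tendsto_intros lim intff fr)
  have limL: "(\<lambda>n. ip M (i n) (\<lambda>x. h x * \<delta> x)) \<longlonglongrightarrow> (\<integral>x. h x * \<delta> x \<partial>M)"
    using \<delta> bounded_L2D(1)[OF h(1)] by (intro lim) auto
  have "(\<integral>x. h x * \<delta> x \<partial>M) \<le> K * ((\<integral>x. (f x)\<^sup>2 \<partial>M) - (\<integral>x. (g x)\<^sup>2 \<partial>M)
      - 2 * ((\<integral>x. f x * res \<alpha> f x \<partial>M) - (\<integral>x. g x * res \<alpha> g x \<partial>M)) + (ip M f f - ip M g g))"
    by (rule LIMSEQ_le[OF limL limR]) (use step in blast)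
  also have "\<dots> = 2 * K * ((ip M f f - ip M (res \<alpha> f) f) - (ip M g g - ip M (res \<alpha> g) g))"
    unfolding ip_def by (simp add: power2_eq_square mult.commute[of "res \<alpha> _ _"] algebra_simps)
  finally have "\<alpha> * ip M h \<delta> \<le> \<alpha> * (2 * K * ((ip M f f - ip M (res \<alpha> f) f) - (ip M g g - ip M (res \<alpha> g) g)))"
    using \<alpha> unfolding ip_def by (intro mult_left_mono) auto
  also have "\<dots> = 2 * K * (energy \<alpha> f - energy \<alpha> g)"
    unfolding energy_def by (simp add: algebra_simps)
  also have "ip M h \<delta> = ip M h (energy_density \<alpha> f) - ip M h (energy_density \<alpha> g)"
    unfolding \<delta>_def using bounded_L2D(1)[OF h(1)] L2fun_energy_density[OF \<alpha> f] L2fun_energy_density[OF \<alpha> g]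
    by (intro L2.diff_right) auto
  finally show ?thesis unfolding g_def .
qed

text \<open>The test function 0 with bound \<open>K = 1\<close> makes the left side of
  \<open>energy_density_diff_le\<close> vanish.\<close>

lemma energy_contraction:
  assumes "\<alpha> \<ge> 1" "f \<in> bounded_L2 M" "normal_contraction N"
  shows "energy \<alpha> (N \<circ> f) \<le> energy \<alpha> f"
proof -
  have "(\<lambda>x. 0) \<in> bounded_L2 M" unfolding bounded_L2_def bounded_iff by auto
  then have "\<alpha> * (ip M (\<lambda>x. 0) (energy_density \<alpha> f) - ip M (\<lambda>x. 0) (energy_density \<alpha> (N \<circ> f)))
    \<le> 2 * 1 * (energy \<alpha> f - energy \<alpha> (N \<circ> f))"
    by (intro energy_density_diff_le assms) auto
  then show ?thesis by (simp add: ip_def)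
qed

text \<open>The energies of \<open>N \<circ> f\<close> are bounded by those of \<open>f\<close>,
  hence by \<open>E f f\<close>; the membership criterion gives both claims.\<close>

lemma
  assumes "f \<in> F" "f \<in> bounded_L2 M" "normal_contraction N"
  shows contraction_in: "N \<circ> f \<in> F"
    and E_contraction: "E (N \<circ> f) (N \<circ> f) \<le> E f f"
proof -
  have "energy \<alpha> (N \<circ> f) \<le> E f f" if "\<alpha> \<ge> 1" for \<alpha>
    using energy_contraction[OF that assms(2,3)] energy_le[OF that assms(1)] by linarith
  moreover have "L2fun M (N \<circ> f)"
    using bounded_L2D(1)[OF bounded_L2_contraction[OF assms(2,3)]] .
  ultimately show "N \<circ> f \<in> F" "E (N \<circ> f) (N \<circ> f) \<le> E f f"
    using energy_bounded_imp_in(1,3) by blast+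
qed

end

section \<open>Supremum norm and unit contraction\<close>

lemma abs_le_supn:
  assumes "bounded (f ` space M)" "x \<in> space M"
  shows "\<bar>f x\<bar> \<le> supn M f"
proof -
  have "bdd_above ((\<lambda>x. \<bar>f x\<bar>) ` space M)"
    using assms(1) unfolding bounded_iff by (auto intro: bdd_aboveI2)
  then show ?thesis unfolding supn_def using assms(2) by (intro cSUP_upper)
qed

lemma T1_contraction: "normal_contraction T1"
  unfolding normal_contraction_def T1_def by (auto simp: min_def max_def)

context dirichlet
begin

section \<open>The Lagrangian\<close>

abbreviation B :: "'a rfun set" where "B \<equiv> bdd_part M F"

lemma in_B_iff: "f \<in> B \<longleftrightarrow> f \<in> F \<and> f \<in> bounded_L2 M"
  unfolding bdd_part_def bounded_L2_def by auto

lemma B_in_F [simp, intro]: "f \<in> B \<Longrightarrow> f \<in> F"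
  unfolding in_B_iff by simp

sublocale EB: nonneg_form B E
proof
  have "(\<lambda>x. c * f x) \<in> B" if "f \<in> B" for c f
    using that bounded_L2_dominated[of f M "\<lambda>x. c * f x" "\<bar>c\<bar>"] unfolding in_B_iff
    by (auto simp: abs_mult)
  moreover have "(\<lambda>x. f x + g x) \<in> B" if "f \<in> B" "g \<in> B" for f g
    using that bounded_plus_comp[of f "space M" g] unfolding bdd_part_def by auto
  moreover have "(\<lambda>x. 0) \<in> B" unfolding bdd_part_def bounded_iff by auto
  ultimately have "lin_subspace B" unfolding lin_subspace_def by blast
  then show "bilinear_form B E"
    unfolding bilinear_form_def using E.sym E.lin_left E.nonneg by simp
qed

lemma B_contraction:
  assumes "f \<in> B" "normal_contraction N"
  shows "N \<circ> f \<in> B" "E (N \<circ> f) (N \<circ> f) \<le> E f f"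
  using assms contraction_in E_contraction bounded_L2_contraction unfolding in_B_iff by auto

lemma B_bound:
  assumes "f \<in> B"
  obtains K where "K > 0" "\<And>x. x \<in> space M \<Longrightarrow> \<bar>f x\<bar> \<le> K"
proof -
  obtain K where "K \<ge> 0" "\<forall>x\<in>space M. \<bar>f x\<bar> \<le> K"
    using bounded_L2D(3) assms unfolding in_B_iff by blast
  then show thesis by (intro that[of "K + 1"]) fastforce+
qed

text \<open>On the range of \<open>f\<close> the square is \<open>2 * K\<close> times a normal
  contraction, since the derivative of the square is at most \<open>2 * K\<close> in absolute value
  on [-K, K]; cutting at height \<open>K\<close> makes this global. The two functions agree on the
  space only, so saturation under almost everywhere equality is used.\<close>

lemma B_square:
  assumes f: "f \<in> B"
  shows "(\<lambda>x. (f x)\<^sup>2) \<in> B"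
proof -
  obtain K where K: "K > 0" "\<And>x. x \<in> space M \<Longrightarrow> \<bar>f x\<bar> \<le> K" using B_bound[OF f] by blast
  define cut where "cut t = max (- K) (min t K)" for t
  define N where "N t = (cut t)\<^sup>2 / (2 * K)" for t
  have "normal_contraction N"
    unfolding normal_contraction_def
  proof (intro conjI allI)
    show "N 0 = 0" using K(1) by (simp add: N_def cut_def)
    fix s t
    have "\<bar>cut s + cut t\<bar> \<le> 2 * K" "\<bar>cut s - cut t\<bar> \<le> \<bar>s - t\<bar>" using K(1) unfolding cut_def by linarith+
    then have "\<bar>cut s + cut t\<bar> * \<bar>cut s - cut t\<bar> \<le> (2 * K) * \<bar>s - t\<bar>"
      by (intro mult_mono) auto
    moreover have "N s - N t = (cut s + cut t) * (cut s - cut t) / (2 * K)"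
      unfolding N_def by (simp add: power2_eq_square algebra_simps diff_divide_distrib)
    ultimately show "\<bar>N s - N t\<bar> \<le> \<bar>s - t\<bar>"
      using K(1) by (simp add: abs_mult divide_le_eq mult.commute)
  qed
  then have "N \<circ> f \<in> F" using B_contraction(1)[OF f] by (intro B_in_F)
  then have "(\<lambda>x. 2 * K * (N \<circ> f) x) \<in> F" by (rule E.scale_in)
  moreover have sq: "(\<lambda>x. (f x)\<^sup>2) \<in> bounded_L2 M" using f bounded_L2_square unfolding in_B_iff by blast
  moreover have "AE x in M. 2 * K * (N \<circ> f) x = (f x)\<^sup>2"
  proof (rule AE_I2)
    fix x assume "x \<in> space M"
    then have "cut (f x) = f x" using K(2)[of x] unfolding cut_def by linarith
    then show "2 * K * (N \<circ> f) x = (f x)\<^sup>2" using K(1) unfolding N_def by simp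
  qed
  ultimately show ?thesis
    using AE_in[of "\<lambda>x. 2 * K * (N \<circ> f) x" "\<lambda>x. (f x)\<^sup>2"] bounded_L2D(2)[OF sq] unfolding in_B_iff by blast
qed

lemma B_mult [simp, intro]:
  assumes "f \<in> B" "g \<in> B"
  shows "(\<lambda>x. f x * g x) \<in> B"
proof -
  have "(\<lambda>x. (1/2) * ((f x + g x)\<^sup>2 - (f x)\<^sup>2 - (g x)\<^sup>2)) \<in> B"
    using assms by (intro EB.scale_in EB.diff_in B_square EB.add_in)
  moreover have "(\<lambda>x. (1/2) * ((f x + g x)\<^sup>2 - (f x)\<^sup>2 - (g x)\<^sup>2)) = (\<lambda>x. f x * g x)"
    by (auto simp: power2_eq_square algebra_simps)
  ultimately show ?thesis by simp
qed

text \<open>The polarized Lagrangian in closed trilinear form; \<open>Lag_polarization\<close>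
  identifies it with the difference of squares.\<close>

definition Lag :: "'a rfun \<Rightarrow> 'a rfun \<Rightarrow> 'a rfun \<Rightarrow> real" where
  "Lag f g h = E (\<lambda>x. f x * h x) g + E (\<lambda>x. g x * h x) f - E (\<lambda>x. f x * g x) h"

lemma Lag_sym: "Lag f g h = Lag g f h"
  unfolding Lag_def by (simp add: mult.commute)

text \<open>Rotating the arguments cancels two of the three form terms. In closability
  \<open>f\<close> is uniformly small, and the rotation moves it into the test slot.\<close>

lemma Lag_cycle:
  "f \<in> B \<Longrightarrow> g \<in> B \<Longrightarrow> h \<in> B \<Longrightarrow> Lag f g h + Lag g h f = 2 * E (\<lambda>x. f x * h x) g"
  unfolding Lag_def by (simp add: mult.commute)

lemma Lag_lin_left:
  assumes "f \<in> B" "f' \<in> B" "g \<in> B" "h \<in> B"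
  shows "Lag (\<lambda>x. c * f x + f' x) g h = c * Lag f g h + Lag f' g h"
proof -
  have eq: "(\<lambda>x. (c * f x + f' x) * k x) = (\<lambda>x. c * (f x * k x) + f' x * k x)" for k :: "'a rfun"
    by (simp add: algebra_simps)
  have "E (\<lambda>x. g x * h x) (\<lambda>x. c * f x + f' x) = c * E (\<lambda>x. g x * h x) f + E (\<lambda>x. g x * h x) f'"
    using assms by (subst EB.add_right) (auto simp: EB.scale_right)
  then show ?thesis
    unfolding Lag_def eq using assms by (simp add: EB.lin_left right_diff_distrib distrib_left)
qed

lemma Lag_lin_right:
  assumes "f \<in> B" "g \<in> B" "h \<in> B" "h' \<in> B"
  shows "Lag f g (\<lambda>x. c * h x + h' x) = c * Lag f g h + Lag f g h'"
proof -
  have eq: "(\<lambda>x. k x * (c * h x + h' x)) = (\<lambda>x. c * (k x * h x) + k x * h' x)" for k :: "'a rfun"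
    by (simp add: algebra_simps)
  have "E (\<lambda>x. f x * g x) (\<lambda>x. c * h x + h' x) = c * E (\<lambda>x. f x * g x) h + E (\<lambda>x. f x * g x) h'"
    using assms by (subst EB.add_right) (auto simp: EB.scale_right)
  then show ?thesis
    unfolding Lag_def eq using assms by (simp add: EB.lin_left right_diff_distrib distrib_left)
qed

lemma Lag_zero [simp]: "h \<in> B \<Longrightarrow> Lag (\<lambda>x. 0) (\<lambda>x. 0) h = 0"
  unfolding Lag_def by simp

lemma Lag_diag: "Lag f f h = 2 * E (\<lambda>x. f x * h x) f - E (\<lambda>x. (f x)\<^sup>2) h"
  unfolding Lag_def by (simp add: power2_eq_square)

lemma Lag_polarization:
  assumes "f \<in> B" "g \<in> B" "h \<in> B"
  shows "Lag f g h = (Lag (\<lambda>x. f x + g x) (\<lambda>x. f x + g x) h - Lag (\<lambda>x. f x - g x) (\<lambda>x. f x - g x) h) / 4"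
proof -
  have left: "Lag (\<lambda>x. f x + c * g x) k h = Lag f k h + c * Lag g k h" if "k \<in> B" for c k
    using Lag_lin_left[of g f k h c] assms that by (simp add: add.commute)
  have "Lag (\<lambda>x. f x + c * g x) (\<lambda>x. f x + c * g x) h
      = Lag f f h + 2 * c * Lag f g h + c\<^sup>2 * Lag g g h" for c
    using assms left[of "\<lambda>x. f x + c * g x" c] left[of f c] left[of g c]
      Lag_sym[of f "\<lambda>x. f x + c * g x"] Lag_sym[of g "\<lambda>x. f x + c * g x"] Lag_sym[of g f]
    by (simp add: distrib_left power2_eq_square)
  from this[of 1] this[of "-1"] show ?thesis by simp
qed

text \<open>For every parameter \<open>E_res\<close> and the symmetry of \<open>res\<close> turn the
  integral into \<open>2 * E (res \<alpha> f) (f h) - E (res \<alpha> (f\<^sup>2)) h\<close>, and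
  each term converges as the resolvents do.\<close>

lemma energy_density_tendsto:
  assumes f: "f \<in> B" and h: "h \<in> B"
  shows "(\<lambda>n. real (Suc n) * ip M h (energy_density (real (Suc n)) f)) \<longlonglongrightarrow> Lag f f h"
proof -
  have bf: "f \<in> bounded_L2 M" using f unfolding in_B_iff by simp
  have sq: "(\<lambda>x. (f x)\<^sup>2) \<in> B" by (rule B_square[OF f])
  have fh: "(\<lambda>x. f x * h x) \<in> B" using f h by auto
  have "(\<lambda>n. 2 * E (res (real (Suc n)) f) (\<lambda>x. f x * h x) - E (res (real (Suc n)) (\<lambda>x. (f x)\<^sup>2)) h)
      \<longlonglongrightarrow> 2 * E f (\<lambda>x. f x * h x) - E (\<lambda>x. (f x)\<^sup>2) h"
    using f h sq fh by (intro tendsto_intros E_res_tendsto) auto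
  moreover have "2 * E f (\<lambda>x. f x * h x) - E (\<lambda>x. (f x)\<^sup>2) h = Lag f f h"
    unfolding Lag_diag using EB.sym[OF f fh] by simp
  moreover have "2 * E (res \<alpha> f) (\<lambda>x. f x * h x) - E (res \<alpha> (\<lambda>x. (f x)\<^sup>2)) h
      = \<alpha> * ip M h (energy_density \<alpha> f)" if "\<alpha> \<ge> 1" for \<alpha>
  proof -
    have 1: "E (res \<alpha> f) (\<lambda>x. f x * h x) = \<alpha> * (ip M f (\<lambda>x. f x * h x) - ip M (res \<alpha> f) (\<lambda>x. f x * h x))"
      using that f fh by (intro E_res) auto
    have 2: "E (res \<alpha> (\<lambda>x. (f x)\<^sup>2)) h = \<alpha> * (ip M (\<lambda>x. (f x)\<^sup>2) h - ip M (res \<alpha> (\<lambda>x. (f x)\<^sup>2)) h)"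
      using that sq h by (intro E_res) auto
    have 3: "ip M h (energy_density \<alpha> f) = ip M h (\<lambda>x. (f x)\<^sup>2)
        - 2 * ip M h (\<lambda>x. f x * res \<alpha> f x) + ip M (res \<alpha> h) (\<lambda>x. (f x)\<^sup>2)"
      using that h by (intro ip_energy_density bf) auto
    have 4: "ip M f (\<lambda>x. f x * h x) = ip M h (\<lambda>x. (f x)\<^sup>2)"
      "ip M (\<lambda>x. (f x)\<^sup>2) h = ip M h (\<lambda>x. (f x)\<^sup>2)"
      "ip M (res \<alpha> f) (\<lambda>x. f x * h x) = ip M h (\<lambda>x. f x * res \<alpha> f x)"
      unfolding ip_def by (simp_all add: power2_eq_square mult_ac)
    have 5: "ip M (res \<alpha> (\<lambda>x. (f x)\<^sup>2)) h = ip M (res \<alpha> h) (\<lambda>x. (f x)\<^sup>2)"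
      using that h sq by (subst res_sym) (auto simp: ip_commute)
    show ?thesis unfolding 1 2 3 4 5 by (simp add: algebra_simps)
  qed
  ultimately show ?thesis by simp
qed

text \<open>The almost everywhere inequality of the densities, integrated against \<open>h\<close>
  and passed to the limit.\<close>

lemma Lag_contraction:
  assumes f: "f \<in> B" and h: "h \<in> B" and "nonneg_fun M h" and N: "normal_contraction N"
  shows "Lag (N \<circ> f) (N \<circ> f) h \<le> Lag f f h"
proof (rule LIMSEQ_le[OF energy_density_tendsto[OF B_contraction(1)[OF f N] h] energy_density_tendsto[OF f h]])
  have bf: "f \<in> bounded_L2 M" using f unfolding in_B_iff by simp
  have "ip M h (energy_density \<alpha> (N \<circ> f)) \<le> ip M h (energy_density \<alpha> f)" if "\<alpha> \<ge> 1" for \<alpha>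
    unfolding ip_def
  proof (rule integral_mono_AE)
    show "AE x in M. h x * energy_density \<alpha> (N \<circ> f) x \<le> h x * energy_density \<alpha> f x"
      using energy_density_contraction[OF that bf N] AE_space
      by eventually_elim (use \<open>nonneg_fun M h\<close> in \<open>auto simp: nonneg_fun_def intro: mult_left_mono\<close>)
  qed (use h L2fun_energy_density[OF that bf] L2fun_energy_density[OF that bounded_L2_contraction[OF bf N]] in auto)
  then show "\<exists>n0. \<forall>n\<ge>n0. real (Suc n) * ip M h (energy_density (real (Suc n)) (N \<circ> f))
      \<le> real (Suc n) * ip M h (energy_density (real (Suc n)) f)"
    by (intro exI[of _ 0] allI impI mult_left_mono) auto
qed

lemma zero_contraction: "normal_contraction (\<lambda>t. 0)"
  unfolding normal_contraction_def by simp

lemma Lag_nonneg: "f \<in> B \<Longrightarrow> h \<in> B \<Longrightarrow> nonneg_fun M h \<Longrightarrow> 0 \<le> Lag f f h"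
  using Lag_contraction[OF _ _ _ zero_contraction, of f h] by (simp add: comp_def)

text \<open>\<open>energy_density_diff_le\<close> for the zero contraction: the subtracted density
  belongs to the function 0, whose Lagrangian vanishes.\<close>

lemma Lag_diag_le:
  assumes f: "f \<in> B" and h: "h \<in> B" and K: "K \<ge> 0" "\<And>x. x \<in> space M \<Longrightarrow> \<bar>h x\<bar> \<le> K"
  shows "Lag f f h \<le> 2 * K * E f f"
proof -
  have bf: "f \<in> bounded_L2 M" and bh: "h \<in> bounded_L2 M" using f h unfolding in_B_iff by auto
  have lim: "(\<lambda>n. real (Suc n) * (ip M h (energy_density (real (Suc n)) f)
      - ip M h (energy_density (real (Suc n)) (\<lambda>x. 0)))) \<longlonglongrightarrow> Lag f f h - Lag (\<lambda>x. 0) (\<lambda>x. 0) h"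
    unfolding right_diff_distrib by (intro tendsto_intros energy_density_tendsto f h EB.zero_in)
  have "real (Suc n) * (ip M h (energy_density (real (Suc n)) f)
      - ip M h (energy_density (real (Suc n)) (\<lambda>x. 0))) \<le> 2 * K * E f f" for n
  proof -
    have "real (Suc n) * (ip M h (energy_density (real (Suc n)) f)
        - ip M h (energy_density (real (Suc n)) ((\<lambda>t. 0) \<circ> f)))
      \<le> 2 * K * (energy (real (Suc n)) f - energy (real (Suc n)) ((\<lambda>t. 0) \<circ> f))"
      by (rule energy_density_diff_le) (use bf bh K zero_contraction in auto)
    also have "\<dots> \<le> 2 * K * E f f"
    proof (rule mult_left_mono)
      have "0 \<le> energy (real (Suc n)) (\<lambda>x. 0)" by (rule energy_bounds(1)) auto
      then show "energy (real (Suc n)) f - energy (real (Suc n)) ((\<lambda>t. 0) \<circ> f) \<le> E f f"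
        using energy_le[of "real (Suc n)" f] f unfolding comp_def by auto
    qed (use K in simp)
    finally show ?thesis unfolding comp_def .
  qed
  then have "Lag f f h - Lag (\<lambda>x. 0) (\<lambda>x. 0) h \<le> 2 * K * E f f"
    using LIMSEQ_le_const2[OF lim] by blast
  then show ?thesis using h by simp
qed

text \<open>The diagonal bound applied to \<open>h\<close> and to its negative is two-sided;
  polarization and the parallelogram identity extend it off the diagonal.\<close>

lemma Lag_abs_le:
  assumes f: "f \<in> B" and g: "g \<in> B" and h: "h \<in> B"
    and K: "K \<ge> 0" "\<And>x. x \<in> space M \<Longrightarrow> \<bar>h x\<bar> \<le> K"
  shows "\<bar>Lag f g h\<bar> \<le> K * (E f f + E g g)"
proof -
  have diag: "\<bar>Lag u u h\<bar> \<le> 2 * K * E u u" if u: "u \<in> B" for u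
  proof -
    have "Lag u u (\<lambda>x. -1 * h x + 0) \<le> 2 * K * E u u"
      by (rule Lag_diag_le[OF u]) (use EB.scale_in[OF h, of "-1"] K in auto)
    moreover have "Lag u u (\<lambda>x. -1 * h x + (\<lambda>x. 0) x) = -1 * Lag u u h + Lag u u (\<lambda>x. 0)"
      using u h by (intro Lag_lin_right) auto
    moreover have "Lag u u (\<lambda>x. 0) = 0" unfolding Lag_def using u by simp
    ultimately show ?thesis using Lag_diag_le[OF u h K] by simp
  qed
  have "4 * \<bar>Lag f g h\<bar> \<le> 2 * K * E (\<lambda>x. f x + g x) (\<lambda>x. f x + g x)
      + 2 * K * E (\<lambda>x. f x - g x) (\<lambda>x. f x - g x)"
    using diag[OF EB.add_in[OF f g]] diag[OF EB.diff_in[OF f g]] Lag_polarization[OF f g h] by argo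
  also have "\<dots> = 4 * (K * (E f f + E g g))"
    using f g by (simp add: EB.add_self EB.diff_self algebra_simps)
  finally show ?thesis by simp
qed

lemma nonneg_form_Lag:
  assumes h: "h \<in> B" "nonneg_fun M h"
  shows "nonneg_form B (\<lambda>f g. Lag f g h)"
proof
  have "lin_subspace B" using EB.form unfolding bilinear_form_def by blast
  moreover have "\<forall>f\<in>B. \<forall>g\<in>B. Lag f g h = Lag g f h" using Lag_sym by blast
  ultimately show "bilinear_form B (\<lambda>f g. Lag f g h)"
    unfolding bilinear_form_def using Lag_lin_left Lag_nonneg h by simp
qed

section \<open>Closability\<close>

text \<open>\<open>Lag_abs_le\<close> for \<open>4 * P * g\<close>, divided by \<open>4 * P\<close>.
  The weight leaves only a quarter of \<open>E u u\<close>, small enough to be absorbed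
  later.\<close>

lemma Lag_le_quarter:
  assumes u: "u \<in> B" and g: "g \<in> B" and f: "f \<in> B"
    and P: "P > 0" "\<And>x. x \<in> space M \<Longrightarrow> \<bar>f x\<bar> \<le> P"
  shows "Lag u g f \<le> E u u / 4 + 4 * P\<^sup>2 * E g g"
proof -
  have "Lag (\<lambda>x. (4 * P) * g x + (\<lambda>x. 0) x) u f = (4 * P) * Lag g u f + Lag (\<lambda>x. 0) u f"
    by (rule Lag_lin_left) (use u g f in auto)
  moreover have "Lag (\<lambda>x. 0) u f = 0" unfolding Lag_def using u f by simp
  moreover have "\<bar>Lag (\<lambda>x. (4 * P) * g x) u f\<bar> \<le> P * (E (\<lambda>x. (4 * P) * g x) (\<lambda>x. (4 * P) * g x) + E u u)"
    by (rule Lag_abs_le) (use u g f P in auto)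
  moreover have "E (\<lambda>x. (4 * P) * g x) (\<lambda>x. (4 * P) * g x) = 16 * P\<^sup>2 * E g g"
    using g by (simp add: EB.scale_left EB.scale_right power2_eq_square)
  ultimately have "4 * P * Lag u g f \<le> P * (16 * P\<^sup>2 * E g g + E u u)"
    using Lag_sym[of u g f] by simp
  also have "\<dots> = 4 * P * (E u u / 4 + 4 * P\<^sup>2 * E g g)" by (simp add: algebra_simps)
  finally show ?thesis using P(1) by simp
qed

text \<open>For \<open>u = f h\<close>, \<open>Lag_cycle\<close> writes \<open>2 * E u u\<close> as
  two Lagrangian terms, each bounded by a quarter of \<open>E u u\<close> plus known quantities; the
  quarters are absorbed. The second estimate serves closability of the Lagrangian, where a bound on
  \<open>Lag f f h\<close> is available but none on \<open>E f f\<close>.\<close>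

lemma E_mult_le:
  assumes f: "f \<in> B" "\<And>x. x \<in> space M \<Longrightarrow> \<bar>f x\<bar> \<le> P" "P > 0"
    and h: "h \<in> B" "\<And>x. x \<in> space M \<Longrightarrow> \<bar>h x\<bar> \<le> K" "K > 0"
  shows "E (\<lambda>x. f x * h x) (\<lambda>x. f x * h x) \<le> 3 * (K\<^sup>2 * E f f + P\<^sup>2 * E h h)"
    and "nonneg_fun M h \<Longrightarrow>
      E (\<lambda>x. f x * h x) (\<lambda>x. f x * h x) \<le> 2 * K * Lag f f h + 3 * P\<^sup>2 * E h h"
proof -
  define u where "u = (\<lambda>x. f x * h x)"
  have u: "u \<in> B" unfolding u_def using f h by auto
  have cycle: "Lag f u h + Lag u h f = 2 * E u u"
    using Lag_cycle[OF f(1) u h(1)] unfolding u_def .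
  have 1: "Lag u h f \<le> E u u / 4 + 4 * P\<^sup>2 * E h h"
    by (rule Lag_le_quarter[OF u h(1) f(1) f(3,2)])
  have nonneg: "0 \<le> E u u" "0 \<le> E f f" "0 \<le> E h h" "0 \<le> K\<^sup>2 * E f f" "0 \<le> P\<^sup>2 * E h h"
    using u f h by auto
  have "Lag u f h \<le> E u u / 4 + 4 * K\<^sup>2 * E f f"
    by (rule Lag_le_quarter[OF u f(1) h(1) h(3,2)])
  then show "E (\<lambda>x. f x * h x) (\<lambda>x. f x * h x) \<le> 3 * (K\<^sup>2 * E f f + P\<^sup>2 * E h h)"
    using cycle 1 nonneg Lag_sym[of u f h] unfolding u_def[symmetric] by argo
  assume hn: "nonneg_fun M h"
  interpret LB: nonneg_form B "\<lambda>f g. Lag f g h" by (rule nonneg_form_Lag[OF h(1) hn])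
  \<comment> \<open>The weight \<open>4 * K\<close> is matched to
    \<open>Lag u u h \<le> 2 * K * E u u\<close>, so that half of \<open>E u u\<close>
    remains.\<close>
  have "2 * \<bar>Lag f u h\<bar> \<le> (4 * K) * Lag f f h + Lag u u h / (4 * K)"
    by (rule LB.arith_geo_mean_weighted[OF f(1) u]) (use h in auto)
  also have "Lag u u h / (4 * K) \<le> 2 * K * E u u / (4 * K)"
    using Lag_diag_le[OF u h(1) _ h(2)] h(3) by (intro divide_right_mono) auto
  also have "\<dots> = E u u / 2" using h(3) by simp
  finally have "2 * Lag f u h \<le> 4 * K * Lag f f h + E u u / 2" by simp
  moreover have "0 \<le> K * Lag f f h" using h(3) LB.nonneg[OF f(1)] by simp
  ultimately show "E (\<lambda>x. f x * h x) (\<lambda>x. f x * h x) \<le> 2 * K * Lag f f h + 3 * P\<^sup>2 * E h h"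
    using cycle 1 nonneg unfolding u_def[symmetric] by argo
qed

section \<open>Uniformly vanishing sequences\<close>

lemma uniform_bound:
  assumes "\<And>n. fs n \<in> B" "(\<lambda>n. supn M (fs n)) \<longlonglongrightarrow> 0"
  obtains s where "s \<longlonglongrightarrow> 0" "\<And>n. 0 \<le> s n" "\<And>n x. x \<in> space M \<Longrightarrow> \<bar>fs n x\<bar> \<le> s n"
\<comment> \<open>The absolute value secures nonnegativity also on an empty space, where
  \<open>supn\<close> is the supremum of the empty set.\<close>
proof (rule that[of "\<lambda>n. \<bar>supn M (fs n)\<bar>"])
  show "(\<lambda>n. \<bar>supn M (fs n)\<bar>) \<longlonglongrightarrow> 0" using tendsto_rabs_zero[OF assms(2)] .
  show "\<bar>fs n x\<bar> \<le> \<bar>supn M (fs n)\<bar>" if "x \<in> space M" for n x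
    using abs_le_supn[OF _ that, of "fs n"] assms(1)[of n] unfolding bdd_part_def by force
qed auto

text \<open>The square integral of the products is at most \<open>(s n)\<^sup>2 * ip M h h\<close>,
  so boundedness in \<open>E\<close> yields weak convergence by
  \<open>E_weak_tendsto\<close>.\<close>

lemma E_mult_tendsto_zero:
  assumes fs: "\<And>n. fs n \<in> B" and s: "s \<longlonglongrightarrow> 0" "\<And>n x. x \<in> space M \<Longrightarrow> \<bar>fs n x\<bar> \<le> s n"
    and h: "h \<in> B" and g: "g \<in> B"
    and C: "\<forall>\<^sub>F n in sequentially. E (\<lambda>x. fs n x * h x) (\<lambda>x. fs n x * h x) \<le> C"
  shows "(\<lambda>n. E (\<lambda>x. fs n x * h x) g) \<longlonglongrightarrow> 0"
proof (rule E_weak_tendsto[OF _ _ C])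
  show in_F: "(\<lambda>x. fs n x * h x) \<in> F" for n using fs h by auto
  have lim: "(\<lambda>n. (s n)\<^sup>2 * ip M h h) \<longlonglongrightarrow> 0"
    using tendsto_mult[OF tendsto_power[OF s(1), of 2] tendsto_const[of "ip M h h"]] by simp
  have hL: "integrable M (\<lambda>x. h x * h x)" using h by auto
  have le: "ip M (\<lambda>x. fs n x * h x) (\<lambda>x. fs n x * h x) \<le> (s n)\<^sup>2 * ip M h h" for n
  proof -
    have "ip M (\<lambda>x. fs n x * h x) (\<lambda>x. fs n x * h x) \<le> (\<integral>x. (s n)\<^sup>2 * (h x * h x) \<partial>M)"
      unfolding ip_def
    proof (rule integral_mono)
      show "integrable M (\<lambda>x. fs n x * h x * (fs n x * h x))" using in_F[of n] by auto
      fix x assume "x \<in> space M"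
      then have "\<bar>fs n x\<bar>\<^sup>2 \<le> (s n)\<^sup>2" using s(2) by (intro power_mono) auto
      then have "(fs n x)\<^sup>2 * (h x * h x) \<le> (s n)\<^sup>2 * (h x * h x)" by (intro mult_right_mono) auto
      then show "fs n x * h x * (fs n x * h x) \<le> (s n)\<^sup>2 * (h x * h x)"
        by (simp add: power2_eq_square mult_ac)
    qed (use hL in auto)
    then show ?thesis using hL unfolding ip_def by simp
  qed
  have nonneg: "0 \<le> ip M (\<lambda>x. fs n x * h x) (\<lambda>x. fs n x * h x)" for n
    using in_F[of n] by (intro L2.nonneg) auto
  show "(\<lambda>n. ip M (\<lambda>x. fs n x * h x) (\<lambda>x. fs n x * h x)) \<longlonglongrightarrow> 0"
    by (rule tendsto_sandwich[OF always_eventually always_eventually tendsto_const lim])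
       (use le nonneg in blast)+
qed (use g in auto)

lemma Lag_tendsto_zero:
  assumes fs: "\<And>n. fs n \<in> B" and s: "s \<longlonglongrightarrow> 0" "\<And>n. 0 \<le> s n" "\<And>n x. x \<in> space M \<Longrightarrow> \<bar>fs n x\<bar> \<le> s n"
    and h: "h \<in> B" and g: "g \<in> B"
  shows "(\<lambda>n. Lag g h (fs n)) \<longlonglongrightarrow> 0"
proof (rule Lim_null_comparison)
  show "\<forall>\<^sub>F n in sequentially. norm (Lag g h (fs n)) \<le> s n * (E g g + E h h)"
    using Lag_abs_le[OF g h fs s(2) s(3)] by simp
  show "(\<lambda>n. s n * (E g g + E h h)) \<longlonglongrightarrow> 0"
    using tendsto_mult[OF s(1) tendsto_const] by simp
qed

lemma Lag_closable:
  assumes h: "h \<in> B" "nonneg_fun M h"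
  shows "sup_closable M B (\<lambda>f g. Lag f g h)"
  unfolding sup_closable_def
proof (intro allI impI, elim conjE)
  fix fs assume "\<forall>n. fs n \<in> B" and cauchy: "form_cauchy (\<lambda>f g. Lag f g h) fs"
    and sup: "(\<lambda>n. supn M (fs n)) \<longlonglongrightarrow> 0"
  then have fs: "\<And>n. fs n \<in> B" by blast
  interpret LB: nonneg_form B "\<lambda>f g. Lag f g h" by (rule nonneg_form_Lag[OF h])
  obtain s where s: "s \<longlonglongrightarrow> 0" "\<And>n. 0 \<le> s n" "\<And>n x. x \<in> space M \<Longrightarrow> \<bar>fs n x\<bar> \<le> s n"
    using uniform_bound[OF fs sup] by blast
  obtain C N where C: "\<And>n. n \<ge> N \<Longrightarrow> Lag (fs n) (fs n) h \<le> C"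
    using LB.form_cauchy_bounded[OF fs cauchy] by blast
  obtain K where K: "K > 0" "\<And>x. x \<in> space M \<Longrightarrow> \<bar>h x\<bar> \<le> K" using B_bound[OF h(1)] by blast
  \<comment> \<open>Eventually \<open>fs n\<close> is bounded by 1, so \<open>E_mult_le\<close>
    applies with \<open>P = 1\<close>.\<close>
  have "\<forall>\<^sub>F n in sequentially. s n < 1" using order_tendstoD(2)[OF s(1), of 1] by simp
  then have bounded: "\<forall>\<^sub>F n in sequentially. E (\<lambda>x. fs n x * h x) (\<lambda>x. fs n x * h x)
      \<le> 2 * K * C + 3 * 1\<^sup>2 * E h h"
    using eventually_ge_at_top[of N]
  proof eventually_elim
    case (elim n)
    have "\<bar>fs n x\<bar> \<le> 1" if "x \<in> space M" for x using s(3)[OF that, of n] elim(1) by linarith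
    then have "E (\<lambda>x. fs n x * h x) (\<lambda>x. fs n x * h x) \<le> 2 * K * Lag (fs n) (fs n) h + 3 * 1\<^sup>2 * E h h"
      by (intro E_mult_le(2)) (use fs h K in auto)
    also have "\<dots> \<le> 2 * K * C + 3 * 1\<^sup>2 * E h h"
      using C[OF elim(2)] K(1) by simp
    finally show ?case .
  qed
  show "(\<lambda>n. Lag (fs n) (fs n) h) \<longlonglongrightarrow> 0"
  proof (rule LB.tendsto_zero_of_form_cauchy[OF fs cauchy])
    fix m
    \<comment> \<open>\<open>Lag_cycle\<close> solved for \<open>Lag (fs n) (fs m) h\<close>;
      testing against the members \<open>fs m\<close> suffices for a Cauchy sequence.\<close>
    have "(\<lambda>n. 2 * E (\<lambda>x. fs n x * h x) (fs m) - Lag (fs m) h (fs n)) \<longlonglongrightarrow> 2 * 0 - 0"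
      by (intro tendsto_intros E_mult_tendsto_zero[OF fs s(1,3) h(1) fs bounded]
          Lag_tendsto_zero[OF fs s h(1) fs])
    moreover have "2 * E (\<lambda>x. fs n x * h x) (fs m) - Lag (fs m) h (fs n) = Lag (fs n) (fs m) h" for n
      using Lag_cycle[OF fs fs h(1), of n m] by simp
    ultimately show "(\<lambda>n. Lag (fs n) (fs m) h) \<longlonglongrightarrow> 0" by simp
  qed
qed

text \<open>Every \<open>g\<close> is a strong limit of the products \<open>\<phi> \<chi>\<close>, where \<open>\<phi>\<close> is \<open>g\<close> with the values
  in \<open>[-\<epsilon>, \<epsilon>]\<close> shrunk to zero and \<open>\<chi> = min 1 (\<bar>g\<bar> / \<epsilon>)\<close> equals 1 where \<open>\<phi> \<noteq> 0\<close>.\<close>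

lemma approx_by_products:
  assumes g: "g \<in> B" and "e > 0"
  shows "\<exists>p\<in>B. \<exists>c\<in>B. E (\<lambda>x. p x * c x - g x) (\<lambda>x. p x * c x - g x) < e"
proof -
  define d where "d k = inverse (real (Suc k))" for k
  have d: "d k > 0" for k unfolding d_def by simp
  define cl where "cl k t = max (- d k) (min t (d k))" for k t
  define N where "N k t = t - cl k t" for k t
  define p where "p k = N k \<circ> g" for k
  define c where "c k = (\<lambda>t. min 1 \<bar>t\<bar>) \<circ> (\<lambda>x. inverse (d k) * g x)" for k
  have "normal_contraction (N k)" for k
    unfolding normal_contraction_def N_def cl_def using d[of k] by (auto simp: min_def max_def)
  then have p: "p k \<in> B" "E (p k) (p k) \<le> E g g" for k
    unfolding p_def using B_contraction[OF g] by auto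
  have "normal_contraction (\<lambda>t. min 1 \<bar>t\<bar>)" unfolding normal_contraction_def by (auto simp: min_def)
  then have c: "c k \<in> B" for k
    unfolding c_def using g by (intro B_contraction(1)) auto
  have pc: "(\<lambda>x. p k x * c k x) = p k" for k
  proof
    fix x
    have "min 1 \<bar>inverse (d k) * g x\<bar> = 1" if "\<bar>g x\<bar> > d k"
      using that d[of k] by (simp add: abs_mult field_simps)
    moreover have "p k x = 0" if "\<bar>g x\<bar> \<le> d k"
      using that unfolding p_def N_def cl_def by (auto simp: min_def max_def)
    ultimately show "p k x * c k x = p k x" unfolding c_def by fastforce
  qed
  define v where "v k = (\<lambda>x. g x - p k x)" for k
  have v: "v k \<in> B" for k unfolding v_def using g p by auto
  have v_abs: "\<bar>v k x\<bar> \<le> d k" "\<bar>v k x\<bar> \<le> \<bar>g x\<bar>" for k x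
    unfolding v_def p_def N_def cl_def comp_def using d[of k] by (auto simp: min_def max_def)
  have dlim: "d \<longlonglongrightarrow> 0" unfolding d_def by (rule LIMSEQ_inverse_real_of_nat)
  have ip_lim: "(\<lambda>k. ip M (v k) (v k)) \<longlonglongrightarrow> (\<integral>x. 0 \<partial>M)"
    unfolding ip_def
  proof (rule integral_dominated_convergence[where w = "\<lambda>x. g x * g x"])
    show "integrable M (\<lambda>x. g x * g x)" using g by auto
    show "(\<lambda>x. v k x * v k x) \<in> borel_measurable M" for k
      using v[of k] by (intro borel_measurable_times) auto
    show "AE x in M. norm (v k x * v k x) \<le> g x * g x" for k
      using v_abs(2)[of k] by (intro AE_I2) (metis abs_mult abs_mult_self_eq abs_ge_zero mult_mono real_norm_def)
    show "AE x in M. (\<lambda>k. v k x * v k x) \<longlonglongrightarrow> 0"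
    proof (rule AE_I2)
      fix x
      have "(\<lambda>k. v k x) \<longlonglongrightarrow> 0"
        by (rule Lim_null_comparison[OF _ dlim]) (use v_abs(1) in simp)
      from tendsto_mult[OF this this] show "(\<lambda>k. v k x * v k x) \<longlonglongrightarrow> 0" by simp
    qed
  qed auto
  \<comment> \<open>Since \<open>E (p k) (p k) \<le> E g g\<close>, the square of \<open>v k\<close>
    is dominated by its pairing with the fixed \<open>g\<close>; weak convergence of
    \<open>v k\<close> therefore implies strong convergence.\<close>
  have v_E: "E (v k) (v k) \<le> 2 * E (v k) g" for k
    using p[of k] g unfolding v_def by (simp add: EB.diff_self EB.diff_left EB.sym[of g "p k"])
  \<comment> \<open>With weight 1/2 the pairing is at most half of \<open>E (v k) (v k)\<close> plus
    \<open>2 * E g g\<close>, and the half is absorbed.\<close>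
  have "E (v k) (v k) \<le> 4 * E g g" for k
    using v_E[of k] EB.arith_geo_mean_weighted[OF v g, of "1/2" k] by argo
  then have "(\<lambda>k. E (v k) g) \<longlonglongrightarrow> 0"
    using v g ip_lim by (intro E_weak_tendsto[where C = "4 * E g g"]) auto
  then obtain k where "norm (E (v k) g - 0) < e / 2"
    using LIMSEQ_D[of "\<lambda>k. E (v k) g" 0 "e / 2"] \<open>e > 0\<close> by (meson half_gt_zero order_refl)
  then have "E (v k) (v k) < e" using v_E[of k] by auto
  moreover have "E (\<lambda>x. p k x - g x) (\<lambda>x. p k x - g x) = E (v k) (v k)"
    unfolding v_def using g p(1)[of k] by (simp add: EB.diff_self EB.sym[of g "p k"])
  ultimately have "E (\<lambda>x. p k x * c k x - g x) (\<lambda>x. p k x * c k x - g x) < e"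
    unfolding fun_cong[OF pc] by simp
  then show ?thesis using p(1) c by blast
qed

lemma E_closable: "sup_closable M B E"
  unfolding sup_closable_def
proof (intro allI impI, elim conjE)
  fix fs assume "\<forall>n. fs n \<in> B" and cauchy: "form_cauchy E fs"
    and sup: "(\<lambda>n. supn M (fs n)) \<longlonglongrightarrow> 0"
  then have fs: "\<And>n. fs n \<in> B" by blast
  obtain s where s: "s \<longlonglongrightarrow> 0" "\<And>n. 0 \<le> s n" "\<And>n x. x \<in> space M \<Longrightarrow> \<bar>fs n x\<bar> \<le> s n"
    using uniform_bound[OF fs sup] by blast
  obtain C N where C: "\<And>n. n \<ge> N \<Longrightarrow> E (fs n) (fs n) \<le> C"
    using EB.form_cauchy_bounded[OF fs cauchy] by blast
  have "\<forall>\<^sub>F n in sequentially. s n < 1" using order_tendstoD(2)[OF s(1), of 1] by simp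
  then have small: "\<forall>\<^sub>F n in sequentially. s n < 1 \<and> n \<ge> N"
    using eventually_ge_at_top[of N] by eventually_elim simp
  have mult: "(\<lambda>n. E (\<lambda>x. fs n x * h x) g) \<longlonglongrightarrow> 0" if h: "h \<in> B" and g: "g \<in> B" for h g
  proof -
    obtain K where K: "K > 0" "\<And>x. x \<in> space M \<Longrightarrow> \<bar>h x\<bar> \<le> K" using B_bound[OF h] by blast
    have "\<forall>\<^sub>F n in sequentially. E (\<lambda>x. fs n x * h x) (\<lambda>x. fs n x * h x) \<le> 3 * (K\<^sup>2 * C + 1\<^sup>2 * E h h)"
      using small
    proof eventually_elim
      case (elim n)
      have "\<bar>fs n x\<bar> \<le> 1" if "x \<in> space M" for x using s(3)[OF that, of n] elim by linarith
      then have "E (\<lambda>x. fs n x * h x) (\<lambda>x. fs n x * h x) \<le> 3 * (K\<^sup>2 * E (fs n) (fs n) + 1\<^sup>2 * E h h)"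
        by (intro E_mult_le(1)) (use fs h K in auto)
      also have "\<dots> \<le> 3 * (K\<^sup>2 * C + 1\<^sup>2 * E h h)"
        using C[of n] elim by (simp add: mult_left_mono)
      finally show ?case .
    qed
    then show ?thesis by (intro E_mult_tendsto_zero[OF fs s(1,3) h g])
  qed
  have product: "(\<lambda>n. E (fs n) (\<lambda>x. p x * c x)) \<longlonglongrightarrow> 0" if p: "p \<in> B" and c: "c \<in> B" for p c
  proof -
    \<comment> \<open>The definition of \<open>Lag p c (fs n)\<close> solved for its last term:
      every remaining term is a pairing with a product \<open>fs n h\<close> or has the small
      function in the test slot.\<close>
    have "(\<lambda>n. E (\<lambda>x. fs n x * p x) c + E (\<lambda>x. fs n x * c x) p - Lag p c (fs n)) \<longlonglongrightarrow> 0 + 0 - 0"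
      by (intro tendsto_intros mult p c Lag_tendsto_zero[OF fs s])
    moreover have "E (\<lambda>x. fs n x * p x) c + E (\<lambda>x. fs n x * c x) p - Lag p c (fs n)
        = E (fs n) (\<lambda>x. p x * c x)" for n
      using EB.sym[OF fs B_mult[OF p c], of n] unfolding Lag_def by (simp add: mult.commute)
    ultimately show ?thesis by simp
  qed
  have bounded: "\<forall>\<^sub>F n in sequentially. E (fs n) (fs n) \<le> C"
    using small by eventually_elim (use C in auto)
  show "(\<lambda>n. E (fs n) (fs n)) \<longlonglongrightarrow> 0"
  proof (rule EB.tendsto_zero_of_form_cauchy[OF fs cauchy])
    fix m
    show "(\<lambda>n. E (fs n) (fs m)) \<longlonglongrightarrow> 0"
    proof (rule EB.tendsto_zero_of_approximations[OF fs bounded fs])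
      fix e :: real assume "e > 0"
      then obtain p c where "p \<in> B" "c \<in> B"
          "E (\<lambda>x. p x * c x - fs m x) (\<lambda>x. p x * c x - fs m x) < e"
        using approx_by_products[OF fs] by blast
      then show "\<exists>r\<in>B. E (\<lambda>x. r x - fs m x) (\<lambda>x. r x - fs m x) < e \<and> (\<lambda>n. E (fs n) r) \<longlonglongrightarrow> 0"
        using product by (intro bexI[of _ "\<lambda>x. p x * c x"]) auto
    qed
  qed
qed

section \<open>Continuity in the test function and the algebra structure\<close>

lemma Lag_in_dual:
  assumes "f \<in> B" "g \<in> B"
  shows "in_dual M B (Lag f g)"
proof (cases "space M = {}")
  case True
  \<comment> \<open>On an empty space \<open>supn\<close> gives no usable bound, but
    \<open>Lag_abs_le\<close> holds with \<open>K = 0\<close> and the functional vanishes.\<close>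
  then have "\<bar>Lag f g h\<bar> \<le> 0 * supn M h" if "h \<in> B" for h
    using Lag_abs_le[OF assms that, of 0] by simp
  then show ?thesis unfolding in_dual_def using Lag_lin_right[OF assms] by blast
next
  case False
  have bound: "\<bar>Lag f g h\<bar> \<le> (E f f + E g g) * supn M h" if h: "h \<in> B" for h
  proof -
    have bdd: "bounded (h ` space M)" using h unfolding bdd_part_def by simp
    have le: "\<bar>h x\<bar> \<le> supn M h" if "x \<in> space M" for x
      using bdd that by (rule abs_le_supn)
    obtain x where "x \<in> space M" using False by blast
    then have "0 \<le> supn M h" using le[of x] by linarith
    then have "\<bar>Lag f g h\<bar> \<le> supn M h * (E f f + E g g)" using le by (rule Lag_abs_le[OF assms h])
    then show ?thesis by (simp add: mult.commute)
  qed
  show ?thesis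
    unfolding in_dual_def using Lag_lin_right[OF assms] bound
    by (intro conjI exI[of _ "E f f + E g g"]) auto
qed

lemma bounded_algebra_B: "bounded_algebra M B"
proof -
  have "lin_subspace B" using EB.form unfolding bilinear_form_def by blast
  moreover have "normal_contraction (\<lambda>t. min t 1)"
    unfolding normal_contraction_def by (auto simp: min_def)
  then have "(\<lambda>x. min (f x) 1) \<in> B" if "f \<in> B" for f
    using B_contraction(1)[OF that] unfolding comp_def by blast
  moreover have "bounded (f ` space M)" if "f \<in> B" for f using that unfolding bdd_part_def by simp
  ultimately show ?thesis unfolding bounded_algebra_def using B_mult by blast
qed

end

section \<open>Transfer to the polarized Lagrangian\<close>

theorem theoremT:
  fixes M :: "'a measure" and F :: "('a \<Rightarrow> real) set"
    and E :: "('a \<Rightarrow> real) \<Rightarrow> ('a \<Rightarrow> real) \<Rightarrow> real"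
  assumes "sigma_finite_measure M"
    and "dirichlet_form M F E"
  defines "B \<equiv> bdd_part M F"
    and "Lq \<equiv> (\<lambda>f h. 2 * E (\<lambda>x. f x * h x) f - E (\<lambda>x. (f x)\<^sup>2) h)"
  defines "L \<equiv> (\<lambda>f g h. (Lq (\<lambda>x. f x + g x) h - Lq (\<lambda>x. f x - g x) h) / 4)"
  shows "lagrangian M B L \<and> lagr_sup_closable M B L \<and> lagr_contractions_operate M B L
         \<and> bilinear_form B E \<and> sup_closable M B E \<and> contractions_operate B E"
proof -
  interpret sigma_finite_measure M by (rule assms(1))
  interpret D: dirichlet M F E by unfold_locales (rule assms(2))
  \<comment> \<open>The agreement is established for arguments in \<open>B\<close>, so each property
    is transferred together with the memberships it needs.\<close>
  have eq: "L f g h = D.Lag f g h" if "f \<in> B" "g \<in> B" "h \<in> B" for f g h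
    using D.Lag_polarization that unfolding B_def L_def Lq_def D.Lag_diag by simp
  have [simp]: "(\<lambda>x. c * f x + g x) \<in> B" "(\<lambda>x. f x - g x) \<in> B"
    if "f \<in> B" "g \<in> B" for c f g
    using that unfolding B_def by (intro D.EB.add_in D.EB.scale_in D.EB.diff_in; simp)+
  have contr: "N \<circ> f \<in> B" if "f \<in> B" "normal_contraction N" for f N
    using D.B_contraction(1) that unfolding B_def by blast
  have dual: "in_dual M B (L f g)" if fg: "f \<in> B" "g \<in> B" for f g
  proof -
    have "in_dual M B (D.Lag f g)" using D.Lag_in_dual fg unfolding B_def by blast
    then show ?thesis unfolding in_dual_def using fg by (simp add: eq)
  qed
  have "lagrangian M B L"
    unfolding lagrangian_def
  proof (intro conjI ballI allI impI)
    show "bounded_algebra M B" unfolding B_def by (rule D.bounded_algebra_B)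
    show "L f g h = L g f h" if "f \<in> B" "g \<in> B" "h \<in> B" for f g h
      using that D.Lag_sym[of f g] by (simp add: eq)
    show "L (\<lambda>x. c * f x + f' x) g h = c * L f g h + L f' g h"
      if "f \<in> B" "f' \<in> B" "g \<in> B" "h \<in> B" for c f f' g h
      using that D.Lag_lin_left[folded B_def] by (simp add: eq)
    show "0 \<le> L f f h" if "f \<in> B" "h \<in> B" "nonneg_fun M h" for f h
      using that D.Lag_nonneg[folded B_def] by (simp add: eq)
    show "L (T1 \<circ> f) (T1 \<circ> f) h \<le> L f f h" if "f \<in> B" "h \<in> B" "nonneg_fun M h" for f h
      using that D.Lag_contraction[folded B_def] contr T1_contraction by (simp add: eq)
  qed (rule dual)
  moreover have "lagr_sup_closable M B L"
    unfolding lagr_sup_closable_def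
  proof (intro ballI impI)
    fix h assume h: "h \<in> B" "nonneg_fun M h"
    then have "sup_closable M B (\<lambda>f g. D.Lag f g h)" using D.Lag_closable unfolding B_def by blast
    \<comment> \<open>The Cauchy condition evaluates the forms at differences of members, which stay
      in \<open>B\<close>.\<close>
    moreover have "form_cauchy (\<lambda>f g. L f g h) fs \<longleftrightarrow> form_cauchy (\<lambda>f g. D.Lag f g h) fs"
      if "\<forall>n. fs n \<in> B" for fs
      using that h unfolding form_cauchy_def by (simp add: eq)
    ultimately show "sup_closable M B (\<lambda>f g. L f g h)"
      unfolding sup_closable_def using h by (auto simp: eq)
  qed
  moreover have "lagr_contractions_operate M B L"
    using D.Lag_contraction[folded B_def] contr unfolding lagr_contractions_operate_def
    by (simp add: eq)
  moreover have "contractions_operate B E"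
    using D.B_contraction unfolding contractions_operate_def B_def by blast
  moreover have "bilinear_form B E" unfolding B_def by (rule D.EB.form)
  moreover have "sup_closable M B E" unfolding B_def by (rule D.E_closable)
  ultimately show ?thesis by blast
qed

end
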